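(* Let $\lambda$ be a real number which does not belong to the essential spectrum $\sigma_{ess}$ (common to all operators of $\mathcal A$), let $H_0\in\mathcal A$, $V=F^*JF\in\mathcal A_0(F)$ be such that the line $\{H_r=H_0+rV:r\in\mathbb R\}$ is regular at $\lambda$, and let $r_\lambda$ be a real resonance point of the triple $(\lambda;H_0,V)$ (that is, $\lambda$ is an eigenvalue of $H_{r_\lambda}$). Let $s$ be any non-resonant point of the triple $(\lambda;H_0,V)$. Then the rigging operator $F$ is a linear isomorphism of the vector space $\mathcal V_\lambda$ of eigenvectors of $H_{r_\lambda}$ corresponding to the eigenvalue $\lambda$ onto the vector space $\Upsilon^1_{\lambda+i0}(r_\lambda)$ of eigenvectors of the operator $T_{\lambda+i0}(H_s)J$ corresponding to the eigenvalue $(s-r_\lambda)^{-1}$ (both spaces including the zero vector).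
   Context: Setting. $\mathcal H,\mathcal K$ are complex separable Hilbert spaces. $F:\mathcal H\to\mathcal K$ is a closed densely defined operator with trivial kernel and co-kernel (the rigging operator). $\mathcal A_0(F)$ is a real vector space of self-adjoint operators $V$ on $\mathcal H$ of the form $V=F^*JF$, where $J$ runs over a real subspace of the bounded self-adjoint operators on $\mathcal K$, and $\mathcal A=H+\mathcal A_0(F)$ is an affine space of self-adjoint operators on $\mathcal H$. Write $R_z(H)=(H-z)^{-1}$. Standing assumptions: all $H\in\mathcal A$ have a common dense domain $\mathcal D$; $\mathcal D\subset\operatorname{dom}(F)$ and $\mathcal D\subset\operatorname{dom}(V)$ for all $V\in\mathcal A_0(F)$; every $V\in\mathcal A_0(F)$ is relatively compact with respect to every $H\in\mathcal A$ (hence all $H\in\mathcal A$ have a common essential spectrum $\sigma_{ess}$); and for non-real $z$ the operator $T_z(H):=FR_z(H)F^*$ (densely defined on $\operatorname{dom}F^*$) extends to a compact operator on $\mathcal K$, also denoted $T_z(H)$. $\Lambda(H,F)$ is the set of real $\lambda$ for which the norm limit $T_{\lambda+i0}(H):=\lim_{y\to0^+}T_{\lambda+iy}(H)$ exists; it is assumed to have full Lebesgue measure for every $H\in\mathcal A$. Elements of $\bigcup_{H\in\mathcal A}\Lambda(H,F)$ are called essentially regular. $H\in\mathcal A$ is regular at an essentially regular $\lambda$ if $\lambda\in\Lambda(H,F)$ and resonant at $\lambda$ otherwise. The line $\{H_0+rV\}$ is regular at $\lambda$ if some $H_r$ is regular at $\lambda$; a real $r$ is non-resonant if $H_r$ is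 regular at $\lambda$ and is a resonance point of the triple $(\lambda;H_0,V)$ otherwise. The space $\Upsilon^1_{\lambda+i0}(r_\lambda)=\{u\in\mathcal K:(1+(r_\lambda-s)T_{\lambda+i0}(H_s)J)u=0\}$ does not depend on the choice of the non-resonant real $s$. *)

theory Defs
  imports "HOL-Analysis.Analysis"
begin

section \<open>Complex Hilbert spaces\<close>

text \<open>
  The inner product is conjugate linear in the first and linear in the second argument. Extending
  \<^class>\<open>real_inner\<close> by \<open>inner x y = Re (cinner x y)\<close> makes the norm and the topology those
  of the complex inner product.
\<close>

class complex_inner = real_inner +
  fixes scaleC :: "complex \<Rightarrow> 'a \<Rightarrow> 'a"  (infixr \<open>*\<^sub>C\<close> 75)
    and cinner :: "'a \<Rightarrow> 'a \<Rightarrow> complex"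
  assumes scaleC_add_right: "c *\<^sub>C (x + y) = c *\<^sub>C x + c *\<^sub>C y"
    and scaleC_add_left: "(c + d) *\<^sub>C x = c *\<^sub>C x + d *\<^sub>C x"
    and scaleC_scaleC: "c *\<^sub>C (d *\<^sub>C x) = (c * d) *\<^sub>C x"
    and scaleC_of_real: "complex_of_real r *\<^sub>C x = r *\<^sub>R x"
    and cinner_commute: "cinner x y = cnj (cinner y x)"
    and cinner_add_right: "cinner x (y + z) = cinner x y + cinner x z"
    and cinner_scaleC_right: "cinner x (c *\<^sub>C y) = c * cinner x y"
    and inner_eq_Re_cinner: "inner x y = Re (cinner x y)"

class complex_hilbert = complex_inner + complete_space

definition csubspace :: "'a::complex_inner set \<Rightarrow> bool" where
  "csubspace S \<longleftrightarrow> 0 \<in> S \<and> (\<forall>x\<in>S. \<forall>y\<in>S. x + y \<in> S) \<and> (\<forall>c. \<forall>x\<in>S. c *\<^sub>C x \<in> S)"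

definition linear_isomorphism_on ::
    "('a::complex_inner \<Rightarrow> 'b::complex_inner) \<Rightarrow> 'a set \<Rightarrow> 'b set \<Rightarrow> bool" where
  "linear_isomorphism_on f S T \<longleftrightarrow>
     csubspace S \<and> csubspace T \<and>
     (\<forall>x\<in>S. \<forall>y\<in>S. f (x + y) = f x + f y) \<and>
     (\<forall>c. \<forall>x\<in>S. f (c *\<^sub>C x) = c *\<^sub>C f x) \<and>
     bij_betw f S T"


section \<open>Unbounded operators\<close>

text \<open>
  An operator is identified with its graph, so equality of operators includes equality of
  domains, inclusion means extension, \<^const>\<open>Domain\<close> and \<^const>\<open>Range\<close> are the
  domain and the range, and \<^const>\<open>closure\<close> is the closure of an operator. Note that in the
  relational composition \<open>A O B\<close> the operator \<open>A\<close> is applied first.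
\<close>

type_synonym ('a, 'b) oper = "('a \<times> 'b) set"

definition linear_operator :: "('a::complex_inner, 'b::complex_inner) oper \<Rightarrow> bool" where
  "linear_operator A \<longleftrightarrow>
     single_valued A \<and> (0, 0) \<in> A \<and>
     (\<forall>x y x' y'. (x, y) \<in> A \<longrightarrow> (x', y') \<in> A \<longrightarrow> (x + x', y + y') \<in> A) \<and>
     (\<forall>c x y. (x, y) \<in> A \<longrightarrow> (c *\<^sub>C x, c *\<^sub>C y) \<in> A)"

definition oper_apply :: "('a, 'b) oper \<Rightarrow> 'a \<Rightarrow> 'b" where
  "oper_apply A x = (THE y. (x, y) \<in> A)"

definition densely_defined :: "('a::complex_inner, 'b::complex_inner) oper \<Rightarrow> bool" where
  "densely_defined A \<longleftrightarrow> closure (Domain A) = UNIV"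

definition oper_kernel :: "('a, 'b::zero) oper \<Rightarrow> 'a set" where
  "oper_kernel A = {x. (x, 0) \<in> A}"

definition oper_add :: "('a, 'b::plus) oper \<Rightarrow> ('a, 'b) oper \<Rightarrow> ('a, 'b) oper" where
  "oper_add A B = {(x, y + z) | x y z. (x, y) \<in> A \<and> (x, z) \<in> B}"

definition oper_scale :: "complex \<Rightarrow> ('a, 'b::complex_inner) oper \<Rightarrow> ('a, 'b) oper" where
  "oper_scale c A = {(x, c *\<^sub>C y) | x y. (x, y) \<in> A}"

definition graph_of :: "('a \<Rightarrow> 'b) \<Rightarrow> ('a, 'b) oper" where
  "graph_of f = {(x, f x) | x. True}"

definition oper_adjoint ::
    "('a::complex_inner, 'b::complex_inner) oper \<Rightarrow> ('b, 'a) oper" where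
  "oper_adjoint A = {(y, z). \<forall>x w. (x, w) \<in> A \<longrightarrow> cinner y w = cinner z x}"

definition selfadjoint :: "('a::complex_inner, 'a) oper \<Rightarrow> bool" where
  "selfadjoint A \<longleftrightarrow> linear_operator A \<and> densely_defined A \<and> oper_adjoint A = A"

text \<open>\<open>H - z\<close> and \<open>(H - z)\<^sup>-\<^sup>1\<close>:\<close>

definition oper_shift :: "('a::complex_inner, 'a) oper \<Rightarrow> complex \<Rightarrow> ('a, 'a) oper" where
  "oper_shift H z = oper_add H (graph_of (\<lambda>x. - (z *\<^sub>C x)))"

definition resolvent :: "('a::complex_inner, 'a) oper \<Rightarrow> complex \<Rightarrow> ('a, 'a) oper" where
  "resolvent H z = (oper_shift H z)\<inverse>"

text \<open>The eigenvectors to the eigenvalue \<open>z\<close>, together with the zero vector.\<close>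

definition eigenspace :: "('a::complex_inner, 'a) oper \<Rightarrow> complex \<Rightarrow> 'a set" where
  "eigenspace H z = {x. (x, z *\<^sub>C x) \<in> H}"

definition eigenvalue :: "('a::complex_inner, 'a) oper \<Rightarrow> complex \<Rightarrow> bool" where
  "eigenvalue H z \<longleftrightarrow> (\<exists>x. x \<noteq> 0 \<and> x \<in> eigenspace H z)"

text \<open>
  Finite (co)dimension over the complex numbers is the same as over the reals, so the real
  \<^const>\<open>span\<close> may be used.
\<close>

definition fredholm :: "('a::complex_inner, 'b::complex_inner) oper \<Rightarrow> bool" where
  "fredholm A \<longleftrightarrow>
     linear_operator A \<and> densely_defined A \<and> closed A \<and>
     (\<exists>B. finite B \<and> oper_kernel A \<subseteq> span B) \<and>
     closed (Range A) \<and>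
     (\<exists>B. finite B \<and> span (Range A \<union> B) = UNIV)"

definition ess_spectrum :: "('a::complex_inner, 'a) oper \<Rightarrow> complex set" where
  "ess_spectrum H = {z. \<not> fredholm (oper_shift H z)}"

definition relatively_compact ::
    "('a::complex_inner, 'b::complex_inner) oper \<Rightarrow> ('a, 'c::complex_inner) oper \<Rightarrow> bool" where
  "relatively_compact V H \<longleftrightarrow>
     Domain H \<subseteq> Domain V \<and>
     (\<forall>(u :: nat \<Rightarrow> 'a) v w.
        (\<forall>n. (u n, w n) \<in> H \<and> (u n, v n) \<in> V) \<and> bounded (range u) \<and> bounded (range w) \<longrightarrow>
        (\<exists>k. strict_mono k \<and> convergent (v \<circ> k)))"

text \<open>
  Elements of the type \<open>'a \<Rightarrow>\<^sub>L 'b\<close> are only real linear; complex linearity is required explicitly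
  where it is not automatic.
\<close>

definition compact_operator :: "('a::complex_inner \<Rightarrow>\<^sub>L 'b::complex_inner) \<Rightarrow> bool" where
  "compact_operator T \<longleftrightarrow> compact (closure (blinfun_apply T ` cball 0 1))"

definition bounded_selfadjoint :: "('a::complex_inner \<Rightarrow>\<^sub>L 'a) \<Rightarrow> bool" where
  "bounded_selfadjoint J \<longleftrightarrow>
     (\<forall>c x. blinfun_apply J (c *\<^sub>C x) = c *\<^sub>C blinfun_apply J x) \<and>
     (\<forall>x y. cinner (blinfun_apply J x) y = cinner x (blinfun_apply J y))"


section \<open>Rigged affine spaces of self-adjoint operators\<close>

text \<open>\<open>F\<^sup>* J F\<close> with its natural domain.\<close>

definition rigged_product ::
    "('h::complex_inner, 'k::complex_inner) oper \<Rightarrow> ('k \<Rightarrow>\<^sub>L 'k) \<Rightarrow> ('h, 'h) oper" where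
  "rigged_product F J = F O graph_of (blinfun_apply J) O oper_adjoint F"

text \<open>
  The self-adjoint operator denoted \<open>V = F\<^sup>* J F\<close>. The closure changes nothing when \<open>F\<^sup>* J F\<close> is
  self-adjoint on its natural domain. It is needed because the admissible \<open>J\<close> form a vector space:
  for unbounded \<open>F\<close> and \<open>J = 0\<close> the product \<open>F\<^sup>* J F\<close> is the zero operator on the domain of
  \<open>F\<close>, which is not closed.
\<close>

definition perturbation ::
    "('h::complex_inner, 'k::complex_inner) oper \<Rightarrow> ('k \<Rightarrow>\<^sub>L 'k) \<Rightarrow> ('h, 'h) oper" where
  "perturbation F J = closure (rigged_product F J)"

text \<open>\<open>F R\<^sub>z(H) F\<^sup>*\<close> on its natural domain, and its bounded extension \<open>T\<^sub>z(H)\<close>, which is unique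
  since the adjoint of a closed densely defined operator is densely defined.\<close>

definition sandwiched_resolvent ::
    "('h::complex_inner, 'k::complex_inner) oper \<Rightarrow> ('h, 'h) oper \<Rightarrow> complex \<Rightarrow> ('k, 'k) oper" where
  "sandwiched_resolvent F H z = oper_adjoint F O resolvent H z O F"

definition T_op ::
    "('h::complex_inner, 'k::complex_inner) oper \<Rightarrow> ('h, 'h) oper \<Rightarrow> complex \<Rightarrow> ('k \<Rightarrow>\<^sub>L 'k)" where
  "T_op F H z = (THE T. sandwiched_resolvent F H z \<subseteq> graph_of (blinfun_apply T))"

text \<open>\<open>\<Lambda>(H, F)\<close> and the norm limit \<open>T\<^bsub>\<lambda>+i0\<^esub>(H)\<close>:\<close>

definition Lambda ::
    "('h::complex_inner, 'k::complex_inner) oper \<Rightarrow> ('h, 'h) oper \<Rightarrow> real set" where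
  "Lambda F H = {l. \<exists>L. ((\<lambda>y. T_op F H (Complex l y)) \<longlongrightarrow> L) (at_right 0)}"

definition T_plus ::
    "('h::complex_inner, 'k::complex_inner) oper \<Rightarrow> ('h, 'h) oper \<Rightarrow> real \<Rightarrow> ('k \<Rightarrow>\<^sub>L 'k)" where
  "T_plus F H l = Lim (at_right 0) (\<lambda>y. T_op F H (Complex l y))"

locale rigged_affine_space =
  fixes F :: "('h::complex_hilbert, 'k::complex_hilbert) oper"
    and \<J> :: "('k \<Rightarrow>\<^sub>L 'k) set"
    and \<A> :: "('h, 'h) oper set"
    and \<D> :: "'h set"
  assumes separable_H: "separable_space (euclidean :: 'h topology)"
    and separable_K: "separable_space (euclidean :: 'k topology)"
    and F_linear: "linear_operator F"
    and F_closed: "closed F"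
    and F_dense: "densely_defined F"
    and F_kernel: "oper_kernel F = {0}"
    and F_cokernel: "oper_kernel (oper_adjoint F) = {0}"
    and J_subspace: "subspace \<J>"
    and J_selfadjoint: "J \<in> \<J> \<Longrightarrow> bounded_selfadjoint J"
    and V_selfadjoint: "J \<in> \<J> \<Longrightarrow> selfadjoint (perturbation F J)"
    and A_affine: "\<exists>H. \<A> = {oper_add H (perturbation F J) | J. J \<in> \<J>}"
    and A_selfadjoint: "H \<in> \<A> \<Longrightarrow> selfadjoint H"
    and D_dense: "closure \<D> = UNIV"
    and A_domain: "H \<in> \<A> \<Longrightarrow> Domain H = \<D>"
    and D_subset_F: "\<D> \<subseteq> Domain F"
    and D_subset_V: "J \<in> \<J> \<Longrightarrow> \<D> \<subseteq> Domain (rigged_product F J)"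
    and V_relatively_compact:
      "J \<in> \<J> \<Longrightarrow> H \<in> \<A> \<Longrightarrow> relatively_compact (perturbation F J) H"
    and T_compact: "H \<in> \<A> \<Longrightarrow> Im z \<noteq> 0 \<Longrightarrow>
      \<exists>T. compact_operator T \<and> sandwiched_resolvent F H z \<subseteq> graph_of (blinfun_apply T)"
    and Lambda_full: "H \<in> \<A> \<Longrightarrow> - Lambda F H \<in> null_sets lebesgue"

definition oper_line ::
    "('h::complex_inner, 'h) oper \<Rightarrow> ('h, 'h) oper \<Rightarrow> real \<Rightarrow> ('h, 'h) oper" where
  "oper_line H\<^sub>0 V r = oper_add H\<^sub>0 (oper_scale (complex_of_real r) V)"

definition regular_line :: "('h::complex_inner, 'k::complex_inner) oper \<Rightarrow> real \<Rightarrow>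
    ('h, 'h) oper \<Rightarrow> ('h, 'h) oper \<Rightarrow> bool" where
  "regular_line F l H\<^sub>0 V \<longleftrightarrow> (\<exists>r. l \<in> Lambda F (oper_line H\<^sub>0 V r))"

definition resonance_point :: "('h::complex_inner, 'k::complex_inner) oper \<Rightarrow> real \<Rightarrow>
    ('h, 'h) oper \<Rightarrow> ('h, 'h) oper \<Rightarrow> real \<Rightarrow> bool" where
  "resonance_point F l H\<^sub>0 V r \<longleftrightarrow> l \<notin> Lambda F (oper_line H\<^sub>0 V r)"

text \<open>The space \<open>\<Upsilon>\<^sup>1\<close> of the resonance point \<open>r\<close>, computed from the non-resonant point \<open>s\<close>:\<close>

definition Upsilon1 :: "('h::complex_inner, 'k::complex_inner) oper \<Rightarrow> real \<Rightarrow>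
    ('h, 'h) oper \<Rightarrow> ('k \<Rightarrow>\<^sub>L 'k) \<Rightarrow> real \<Rightarrow> real \<Rightarrow> 'k set" where
  "Upsilon1 F l H\<^sub>0 J s r =
     {u. u + (r - s) *\<^sub>R
           blinfun_apply (T_plus F (oper_line H\<^sub>0 (perturbation F J) s) l) (blinfun_apply J u) = 0}"

end

theory Submission
  imports Defs
begin

text \<open>
  Write \<open>R\<^sub>z\<close> for the resolvent of \<open>H\<^sub>s\<close> and \<open>z = \<lambda> + i y\<close>. Since the imaginary part of the form of
  \<open>T\<^sub>z\<close> at \<open>f\<close> is \<open>y \<parallel>R\<^sub>z F\<^sup>* f\<parallel>\<^sup>2\<close>, boundedness of \<open>T\<^sub>z\<close> gives \<open>y R\<^sub>z F\<^sup>* f \<longlonglongrightarrow> 0\<close>. An eigenvector \<open>x\<close> of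
  \<open>H\<^sub>r\<close> satisfies \<open>F x = (\<lambda> - z) F R\<^sub>z x - (r - s) T\<^sub>z J F x\<close>; letting \<open>y \<rightarrow> 0\<close> (weakly, against the dense
  domain of \<open>F\<^sup>*\<close>) shows that \<open>F x\<close> is a resonance vector. For \<open>r = s\<close> the same computation gives
  \<open>F x = 0\<close>, so \<open>\<lambda>\<close> is not an eigenvalue of an operator that is regular at \<open>\<lambda>\<close>.

  As \<open>\<lambda>\<close> is outside the essential spectrum, an operator of the line without the eigenvalue \<open>\<lambda>\<close>
  satisfies \<open>c \<parallel>x\<parallel> \<le> \<parallel>(H - \<lambda>) x\<parallel>\<close>. Then \<open>R\<^sub>z F\<^sup>*\<close> is bounded uniformly in \<open>y\<close>, which makes \<open>T\<^sub>z\<close>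
  Lipschitz in \<open>y\<close>, so that the operator is regular; hence \<open>\<lambda>\<close> is an eigenvalue at a resonance point.
  At the regular point \<open>s\<close>, the limit of \<open>R\<^sub>z F\<^sup>* f\<close> for \<open>z \<rightarrow> \<lambda>\<close> and \<open>f \<rightarrow> J u\<close> is a multiple of an
  eigenvector of \<open>H\<^sub>r\<close> that \<open>F\<close> maps to the given resonance vector \<open>u\<close>.
\<close>

instance complex_hilbert \<subseteq> banach ..

section \<open>Hilbert space preliminaries\<close>

lemma cinner_scaleC_left: "cinner (c *\<^sub>C x) y = cnj c * cinner x y"
  by (simp add: cinner_commute[of "c *\<^sub>C x" y] cinner_commute[of x y] cinner_scaleC_right)

lemma cinner_self: "cinner x x = complex_of_real ((norm x)\<^sup>2)"
proof (rule complex_eqI)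
  show "Re (cinner x x) = Re (complex_of_real ((norm x)\<^sup>2))"
    by (simp add: inner_eq_Re_cinner [symmetric] power2_norm_eq_inner)
  show "Im (cinner x x) = Im (complex_of_real ((norm x)\<^sup>2))"
    using cinner_commute[of x x] by (metis complex_cnj_cancel_iff Im_complex_of_real cnj.simps(2)
        equal_neg_zero)
qed

lemma norm_scaleC: "norm (c *\<^sub>C (x::'a::complex_inner)) = cmod c * norm x"
proof -
  have "complex_of_real ((norm (c *\<^sub>C x))\<^sup>2) = (c * cnj c) * complex_of_real ((norm x)\<^sup>2)"
    unfolding cinner_self [symmetric] by (simp add: cinner_scaleC_left cinner_scaleC_right)
  also have "\<dots> = complex_of_real ((cmod c * norm x)\<^sup>2)"
    by (simp add: complex_norm_square [symmetric] power_mult_distrib)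
  finally have "(norm (c *\<^sub>C x))\<^sup>2 = (cmod c * norm x)\<^sup>2"
    using of_real_eq_iff by blast
  then show ?thesis
    by (simp add: power2_eq_iff_nonneg)
qed

lemma norm_cinner_le: "cmod (cinner x y) \<le> norm x * norm y"
proof (cases "cinner x y = 0")
  case False
  \<comment> \<open>A unimodular factor turns \<open>cinner x y\<close> onto the positive real axis,
    which reduces the claim to the real Cauchy-Schwarz inequality.\<close>
  define c where "c = cnj (cinner x y) / complex_of_real (cmod (cinner x y))"
  have "c * cinner x y = complex_of_real (cmod (cinner x y))"
    using False by (simp add: c_def complex_norm_square power2_eq_square field_simps)
      (metis complex_norm_square power2_eq_square of_real_mult mult.commute)
  then have "cmod (cinner x y) = inner x (c *\<^sub>C y)"
    by (simp add: inner_eq_Re_cinner cinner_scaleC_right)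
  also have "\<dots> \<le> norm x * norm (c *\<^sub>C y)"
    by (rule norm_cauchy_schwarz)
  also have "norm (c *\<^sub>C y) = norm y"
    using False by (simp add: norm_scaleC c_def norm_divide)
  finally show ?thesis .
qed simp

lemma cinner_add_left: "cinner (x + y) z = cinner x z + cinner y z"
  by (simp add: cinner_commute[of _ z] cinner_add_right)

interpretation cinner: bounded_bilinear "cinner :: 'a::complex_inner \<Rightarrow> 'a \<Rightarrow> complex"
proof
  fix x x' y y' :: 'a and r :: real
  show "cinner (x + x') y = cinner x y + cinner x' y"
    by (rule cinner_add_left)
  show "cinner x (y + y') = cinner x y + cinner x y'"
    by (rule cinner_add_right)
  show "cinner (r *\<^sub>R x) y = r *\<^sub>R cinner x y"
    by (simp add: scaleC_of_real [symmetric] cinner_scaleC_left scaleR_conv_of_real)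
  show "cinner x (r *\<^sub>R y) = r *\<^sub>R cinner x y"
    by (simp add: scaleC_of_real [symmetric] cinner_scaleC_right scaleR_conv_of_real)
  show "\<exists>K. \<forall>x y. norm (cinner x y) \<le> norm (x::'a) * norm y * K"
    by (rule exI[of _ 1]) (simp add: norm_cinner_le)
qed

interpretation scaleC: bounded_bilinear "scaleC :: complex \<Rightarrow> 'a::complex_inner \<Rightarrow> 'a"
proof
  fix c d :: complex and x y :: 'a and r :: real
  show "(c + d) *\<^sub>C x = c *\<^sub>C x + d *\<^sub>C x" "c *\<^sub>C (x + y) = c *\<^sub>C x + c *\<^sub>C y"
    by (rule scaleC_add_left scaleC_add_right)+
  show "(r *\<^sub>R c) *\<^sub>C x = r *\<^sub>R c *\<^sub>C x" "c *\<^sub>C r *\<^sub>R x = r *\<^sub>R c *\<^sub>C x"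
    by (simp_all add: scaleC_of_real [symmetric] scaleC_scaleC scaleR_conv_of_real mult.commute)
  show "\<exists>K. \<forall>c x. norm (c *\<^sub>C (x::'a)) \<le> norm c * norm x * K"
    by (rule exI[of _ 1]) (simp add: norm_scaleC)
qed

section \<open>Complex subspaces, orthogonal decomposition and density\<close>

lemma csubspace_imp_subspace: "csubspace S \<Longrightarrow> subspace S"
  unfolding csubspace_def subspace_def by (metis scaleC_of_real)

lemma csubspace_image:
  assumes "csubspace S" "\<And>x y. x \<in> S \<Longrightarrow> y \<in> S \<Longrightarrow> f (x + y) = f x + f y"
    "\<And>c x. x \<in> S \<Longrightarrow> f (c *\<^sub>C x) = c *\<^sub>C f x"
  shows "csubspace (f ` S)"
proof -
  have "0 \<in> S"
    using assms(1) by (simp add: csubspace_def)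
  then have "f 0 = 0"
    using assms(3)[of 0 0] by (simp add: scaleC.zero_left scaleC.zero_right)
  with assms show ?thesis
    unfolding csubspace_def by (auto simp flip: assms(2,3))
qed

text \<open>Real orthogonality to \<open>s\<close> kills the real part, and real orthogonality to
  \<open>\<i> *\<^sub>C s\<close> the imaginary part.\<close>

lemma csubspace_orthogonal:
  assumes "csubspace S" "\<And>s. s \<in> S \<Longrightarrow> inner q s = 0" "s \<in> S"
  shows "cinner q s = 0"
proof (rule complex_eqI)
  show "Re (cinner q s) = Re 0"
    using assms by (simp add: inner_eq_Re_cinner)
  have "inner q (\<i> *\<^sub>C s) = 0"
    using assms by (simp add: csubspace_def)
  then show "Im (cinner q s) = Im 0"
    by (simp add: inner_eq_Re_cinner cinner_scaleC_right)
qed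

text \<open>A minimizing sequence for the distance from \<open>x\<close> to \<open>S\<close> is
  Cauchy by the parallelogram law; minimality at its limit \<open>p\<close> forces
  \<open>x - p\<close> to be orthogonal to \<open>S\<close>.\<close>

lemma closed_subspace_decomposition:
  fixes S :: "'a::{real_inner,complete_space} set"
  assumes S: "subspace S" "closed S"
  obtains p q where "x = p + q" "p \<in> S" "\<And>s. s \<in> S \<Longrightarrow> inner q s = 0"
proof -
  define d where "d = infdist x S"
  have "S \<noteq> {}"
    using S(1) subspace_0 by blast
  have d_le: "d \<le> norm (x - s)" if "s \<in> S" for s
    using infdist_le[OF that, of x] by (simp add: d_def dist_norm)
  have "d \<ge> 0"
    by (simp add: d_def infdist_nonneg)
  have "\<exists>s\<in>S. norm (x - s) < d + inverse (real (Suc n))" for n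
  proof -
    have "Inf (dist x ` S) < d + inverse (real (Suc n))"
      using \<open>S \<noteq> {}\<close> by (simp add: d_def infdist_def)
    then show ?thesis
      using cInf_lessD[of "dist x ` S"] \<open>S \<noteq> {}\<close> by (auto simp: dist_norm)
  qed
  then obtain s where s: "\<And>n. s n \<in> S" "\<And>n. norm (x - s n) < d + inverse (real (Suc n))"
    by metis
  have lim_d: "(\<lambda>n. norm (x - s n)) \<longlonglongrightarrow> d"
  proof (rule tendsto_sandwich[of "\<lambda>_. d" _ _ "\<lambda>n. d + inverse (real (Suc n))"])
    show "(\<lambda>n. d + inverse (real (Suc n))) \<longlonglongrightarrow> d"
      using tendsto_add[OF tendsto_const[of d] LIMSEQ_inverse_real_of_nat] by simp
    show "\<forall>\<^sub>F n in sequentially. norm (x - s n) \<le> d + inverse (real (Suc n))"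
      using s(2) by (simp add: less_imp_le)
  qed (use d_le s in auto)
  \<comment> \<open>The midpoint of \<open>s m\<close> and \<open>s n\<close> lies in
    \<open>S\<close>, so its distance to \<open>x\<close> is at least \<open>d\<close>.\<close>
  have par: "(norm (s m - s n))\<^sup>2 \<le> 2 * (norm (x - s m))\<^sup>2 + 2 * (norm (x - s n))\<^sup>2 - 4 * d\<^sup>2" for m n
  proof -
    have "(1/2) *\<^sub>R (s m + s n) \<in> S"
      using S(1) s(1) by (simp add: subspace_add subspace_scale)
    then have "d\<^sup>2 \<le> (norm (x - (1/2) *\<^sub>R (s m + s n)))\<^sup>2"
      using d_le \<open>d \<ge> 0\<close> by (simp add: power_mono)
    moreover have "(norm (s m - s n))\<^sup>2 + 4 * (norm (x - (1/2) *\<^sub>R (s m + s n)))\<^sup>2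
        = 2 * (norm (x - s m))\<^sup>2 + 2 * (norm (x - s n))\<^sup>2"
      by (simp add: power2_norm_eq_inner inner_diff_left inner_diff_right inner_add_left
          inner_add_right inner_commute algebra_simps)
    ultimately show ?thesis
      by linarith
  qed
  have "Cauchy s"
  proof (rule metric_CauchyI)
    fix e :: real
    assume "e > 0"
    have "(\<lambda>n. 2 * (norm (x - s n))\<^sup>2 - 2 * d\<^sup>2) \<longlonglongrightarrow> 2 * d\<^sup>2 - 2 * d\<^sup>2"
      by (intro tendsto_intros lim_d)
    then have "\<forall>\<^sub>F n in sequentially. 2 * (norm (x - s n))\<^sup>2 - 2 * d\<^sup>2 < e\<^sup>2 / 2"
      using \<open>e > 0\<close> by (intro order_tendstoD(2)[of _ 0]) simp_all
    then obtain N where N: "\<And>n. n \<ge> N \<Longrightarrow> 2 * (norm (x - s n))\<^sup>2 - 2 * d\<^sup>2 < e\<^sup>2 / 2"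
      unfolding eventually_sequentially by blast
    have "dist (s m) (s n) < e" if "m \<ge> N" "n \<ge> N" for m n
    proof -
      have "(norm (s m - s n))\<^sup>2 < e\<^sup>2"
        using par[of m n] N[OF that(1)] N[OF that(2)] by linarith
      then show ?thesis
        using \<open>e > 0\<close> by (simp add: dist_norm power2_less_imp_less)
    qed
    then show "\<exists>N. \<forall>m\<ge>N. \<forall>n\<ge>N. dist (s m) (s n) < e"
      by blast
  qed
  then obtain p where p: "s \<longlonglongrightarrow> p"
    using Cauchy_convergent_iff convergent_def by blast
  have "p \<in> S"
    using S(2) closed_sequentially p s(1) by blast
  have norm_p: "norm (x - p) = d"
    using LIMSEQ_unique[OF lim_d tendsto_norm[OF tendsto_diff[OF tendsto_const p]]] by simp
  have "inner (x - p) t = 0" if "t \<in> S" for t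
  proof (cases "t = 0")
    case False
    \<comment> \<open>This coefficient minimizes the distance from \<open>x\<close> to
      \<open>p + a *\<^sub>R t\<close>.\<close>
    define a where "a = inner (x - p) t / inner t t"
    have "p + a *\<^sub>R t \<in> S"
      using S(1) \<open>p \<in> S\<close> that by (simp add: subspace_add subspace_scale)
    then have "d\<^sup>2 \<le> (norm (x - (p + a *\<^sub>R t)))\<^sup>2"
      using d_le \<open>d \<ge> 0\<close> by (simp add: power_mono)
    also have "\<dots> = (norm (x - p))\<^sup>2 - 2 * a * inner (x - p) t + a * (a * inner t t)"
      by (simp add: power2_norm_eq_inner inner_diff_left inner_diff_right inner_add_left
          inner_add_right inner_commute algebra_simps)
    also have "a * inner t t = inner (x - p) t"
      using False by (simp add: a_def)
    finally have "a * inner (x - p) t \<le> 0"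
      using norm_p by simp
    then have "(inner (x - p) t)\<^sup>2 / inner t t \<le> 0"
      by (simp add: a_def power2_eq_square)
    moreover have "inner t t > 0"
      using False by simp
    ultimately show ?thesis
      by (simp add: divide_le_0_iff)
  qed simp
  with \<open>p \<in> S\<close> show thesis
    by (intro that[of p "x - p"]) simp_all
qed

lemma subspace_closure:
  fixes S :: "'a::real_normed_vector set"
  assumes "subspace S"
  shows "subspace (closure S)"
proof (rule subspaceI)
  show "0 \<in> closure S"
    using assms closure_subset subspace_0 by blast
  show "x + y \<in> closure S" if "x \<in> closure S" "y \<in> closure S" for x y
  proof -
    obtain u v where "\<And>n. u n \<in> S" "u \<longlonglongrightarrow> x" "\<And>n. v n \<in> S" "v \<longlonglongrightarrow> y"
      using \<open>x \<in> closure S\<close> \<open>y \<in> closure S\<close> unfolding closure_sequential by metis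
    then show ?thesis
      unfolding closure_sequential
      by (intro exI[of _ "\<lambda>n. u n + v n"] conjI allI tendsto_add subspace_add[OF assms])
  qed
  show "c *\<^sub>R x \<in> closure S" if "x \<in> closure S" for c x
  proof -
    obtain u where "\<And>n. u n \<in> S" "u \<longlonglongrightarrow> x"
      using \<open>x \<in> closure S\<close> unfolding closure_sequential by metis
    then show ?thesis
      unfolding closure_sequential
      by (intro exI[of _ "\<lambda>n. c *\<^sub>R u n"] conjI allI tendsto_intros subspace_scale[OF assms])
  qed
qed

lemma dense_subspaceI:
  fixes S :: "'a::{real_inner,complete_space} set"
  assumes "subspace S" and "\<And>q. (\<And>s. s \<in> S \<Longrightarrow> inner q s = 0) \<Longrightarrow> q = 0"
  shows "closure S = UNIV"
proof -
  have "x \<in> closure S" for x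
  proof -
    obtain p q where pq: "x = p + q" "p \<in> closure S" "\<And>s. s \<in> closure S \<Longrightarrow> inner q s = 0"
      using closed_subspace_decomposition[of "closure S" x] subspace_closure[OF assms(1)] by auto
    then have "q = 0"
      using assms(2) closure_subset by blast
    with pq show ?thesis
      by simp
  qed
  then show ?thesis
    by auto
qed

section \<open>Uniform boundedness and finite-dimensional compactness\<close>

text \<open>Uniform boundedness principle: the closed sets \<open>E m\<close> cover the space, so by
  Baire's theorem one of them contains a ball, on which all functionals \<open>inner (x n)\<close>
  share a bound.\<close>

lemma weakly_bounded_imp_bounded:
  fixes x :: "nat \<Rightarrow> 'a::{real_inner,complete_space}"
  assumes "\<And>y. bounded (range (\<lambda>n. inner (x n) y))"
  shows "bounded (range x)"
proof -
  define E where "E m = {y. \<forall>n. \<bar>inner (x n) y\<bar> \<le> real m}" for m :: nat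
  have "closed (E m)" for m
    unfolding E_def by (intro closed_Collect_all closed_Collect_le continuous_intros)
  moreover have "\<Union> (range E) = UNIV"
  proof -
    have "\<exists>m. y \<in> E m" for y
    proof -
      obtain b where "\<And>n. \<bar>inner (x n) y\<bar> \<le> b"
        using assms[of y] by (auto simp: bounded_iff)
      moreover obtain m where "b \<le> real m"
        using real_arch_simple by blast
      ultimately show ?thesis
        by (auto simp: E_def intro: order_trans)
    qed
    then show ?thesis
      by blast
  qed
  moreover have "interior (\<Union> (range E)) = {}" if "\<And>m. interior (E m) = {}"
    using Met_TC.metric_Baire_category_alt[OF mcomplete_iff_complete[THEN iffD2, OF complete_UNIV],
        of "range E"] that \<open>\<And>m. closed (E m)\<close>
    unfolding mtopology_is_euclidean euclidean_interior_of by auto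
  ultimately have "\<exists>m. interior (E m) \<noteq> {}"
    by (metis interior_UNIV UNIV_not_empty)
  then obtain m y where "y \<in> interior (E m)"
    by blast
  then obtain e where e: "e > 0" "cball y e \<subseteq> E m"
    using mem_interior_cball by blast
  have "norm (x n) \<le> 2 * real m / e" for n
  proof (cases "x n = 0")
    case False
    \<comment> \<open>Two points of the ball that differ by length \<open>e\<close> in the direction
      of \<open>x n\<close>; subtracting their bounds isolates
      \<open>e * norm (x n)\<close>.\<close>
    have "y + (e / norm (x n)) *\<^sub>R x n \<in> cball y e" "y \<in> cball y e"
      using e False by (simp_all add: dist_norm)
    then have "\<bar>inner (x n) (y + (e / norm (x n)) *\<^sub>R x n)\<bar> \<le> real m" "\<bar>inner (x n) y\<bar> \<le> real m"
      using e unfolding E_def by blast+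
    moreover have "inner (x n) (y + (e / norm (x n)) *\<^sub>R x n) = inner (x n) y + e * norm (x n)"
      using False by (simp add: inner_add_right dot_square_norm power2_eq_square)
    ultimately show ?thesis
      using e by (simp add: field_simps)
  qed (use e in simp)
  then show ?thesis
    by (auto simp: bounded_iff)
qed

text \<open>In an orthogonal basis Cauchy-Schwarz bounds every coefficient, so the vectors of norm
  at most \<open>M\<close> lie in a finite sum of compact segments.\<close>

lemma bounded_span_subset_compact:
  fixes B :: "'a::real_inner set"
  assumes "finite B"
  shows "\<exists>K. compact K \<and> span B \<inter> cball 0 M \<subseteq> K"
proof -
  obtain C where C: "finite C" "span C = span B" "pairwise orthogonal C"
    using basis_orthogonal[OF assms] by blast
  \<comment> \<open>Removing a possible zero vector makes division by the norms legitimate.\<close>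
  define D where "D = C - {0}"
  have D: "finite D" "span D = span B" "pairwise orthogonal D" "0 \<notin> D"
    using C by (auto simp: D_def pairwise_def)
  define K where "K A = {\<Sum>c\<in>A. a c *\<^sub>R c |a. \<forall>c\<in>A. \<bar>a c\<bar> \<le> M / norm c}" for A :: "'a set"
  have "compact (K A)" if "finite A" for A
    using that
  proof (induction A rule: finite_induct)
    case empty
    then show ?case
      by (simp add: K_def)
  next
    case (insert b A)
    have "compact ((\<lambda>t. t *\<^sub>R b) ` {- (M / norm b)..M / norm b})"
      by (intro compact_continuous_image continuous_intros) simp
    then have "compact {x + y |x y. x \<in> (\<lambda>t. t *\<^sub>R b) ` {- (M / norm b)..M / norm b} \<and> y \<in> K A}"
      using insert.IH by (rule compact_sums)
    also have "{x + y |x y. x \<in> (\<lambda>t. t *\<^sub>R b) ` {- (M / norm b)..M / norm b} \<and> y \<in> K A} = K (insert b A)"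
    proof (intro equalityI subsetI)
      fix z
      assume "z \<in> {x + y |x y. x \<in> (\<lambda>t. t *\<^sub>R b) ` {- (M / norm b)..M / norm b} \<and> y \<in> K A}"
      then obtain t a where "t \<in> {- (M / norm b)..M / norm b}"
          and a: "\<forall>c\<in>A. \<bar>a c\<bar> \<le> M / norm c" and z: "z = t *\<^sub>R b + (\<Sum>c\<in>A. a c *\<^sub>R c)"
        unfolding K_def by blast
      then have t: "\<bar>t\<bar> \<le> M / norm b"
        by (simp add: abs_le_iff)
      have "(\<Sum>c\<in>A. (a(b := t)) c *\<^sub>R c) = (\<Sum>c\<in>A. a c *\<^sub>R c)"
        using insert.hyps by (intro sum.cong) auto
      then have "z = (\<Sum>c\<in>insert b A. (a(b := t)) c *\<^sub>R c)"
        using insert.hyps z by simp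
      moreover have "\<forall>c\<in>insert b A. \<bar>(a(b := t)) c\<bar> \<le> M / norm c"
        using t a by simp
      ultimately show "z \<in> K (insert b A)"
        unfolding K_def by blast
    next
      fix z
      assume "z \<in> K (insert b A)"
      then obtain a where "\<forall>c\<in>insert b A. \<bar>a c\<bar> \<le> M / norm c" "z = a b *\<^sub>R b + (\<Sum>c\<in>A. a c *\<^sub>R c)"
        using insert.hyps by (auto simp: K_def)
      then show "z \<in> {x + y |x y. x \<in> (\<lambda>t. t *\<^sub>R b) ` {- (M / norm b)..M / norm b} \<and> y \<in> K A}"
        unfolding K_def by fastforce
    qed
    finally show ?case .
  qed
  moreover have "span B \<inter> cball 0 M \<subseteq> K D"
  proof
    fix x
    assume x: "x \<in> span B \<inter> cball 0 M"
    then obtain a where a: "x = (\<Sum>c\<in>D. a c *\<^sub>R c)"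
      using span_finite[OF D(1)] D(2) by auto
    have "\<bar>a c\<bar> \<le> M / norm c" if "c \<in> D" for c
    proof -
      have "inner c x = (\<Sum>c'\<in>D. if c' = c then a c * inner c c else 0)"
        unfolding a inner_sum_right
        using D(3) that by (intro sum.cong) (auto simp: pairwise_def orthogonal_def)
      also have "\<dots> = a c * (norm c)\<^sup>2"
        using D(1) that by (simp add: power2_norm_eq_inner)
      finally have "\<bar>a c\<bar> * (norm c)\<^sup>2 = \<bar>inner c x\<bar>"
        by (simp add: abs_mult)
      also have "\<dots> \<le> norm c * M"
        using x by (auto intro!: order_trans[OF Cauchy_Schwarz_ineq2] mult_left_mono)
      finally have "norm c * (\<bar>a c\<bar> * norm c) \<le> norm c * M"
        by (simp add: power2_eq_square algebra_simps)
      moreover have "norm c > 0"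
        using D(4) that by auto
      ultimately show ?thesis
        by (simp add: field_simps)
    qed
    then show "x \<in> K D"
      unfolding K_def a by blast
  qed
  ultimately show ?thesis
    using D(1) by blast
qed

section \<open>Closed, adjoint and self-adjoint operators\<close>

lemma linear_operator_zero: "linear_operator A \<Longrightarrow> (0, 0) \<in> A"
  unfolding linear_operator_def by blast

lemma linear_operator_add:
  "linear_operator A \<Longrightarrow> (x, y) \<in> A \<Longrightarrow> (x', y') \<in> A \<Longrightarrow> (x + x', y + y') \<in> A"
  unfolding linear_operator_def by blast

lemma linear_operator_scaleC: "linear_operator A \<Longrightarrow> (x, y) \<in> A \<Longrightarrow> (c *\<^sub>C x, c *\<^sub>C y) \<in> A"
  unfolding linear_operator_def by blast

lemma linear_operator_scaleR: "linear_operator A \<Longrightarrow> (x, y) \<in> A \<Longrightarrow> (c *\<^sub>R x, c *\<^sub>R y) \<in> A"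
  using linear_operator_scaleC[of A x y "complex_of_real c"] by (simp add: scaleC_of_real)

lemma linear_operator_diff:
  "linear_operator A \<Longrightarrow> (x, y) \<in> A \<Longrightarrow> (x', y') \<in> A \<Longrightarrow> (x - x', y - y') \<in> A"
  using linear_operator_add[of A x y "-x'" "-y'"] linear_operator_scaleR[of A x' y' "-1"] by simp

lemma linear_operator_unique: "linear_operator A \<Longrightarrow> (x, y) \<in> A \<Longrightarrow> (x, y') \<in> A \<Longrightarrow> y = y'"
  unfolding linear_operator_def single_valued_def by blast

lemma csubspace_Range:
  assumes "linear_operator A"
  shows "csubspace (Range A)"
  unfolding csubspace_def
proof (intro conjI ballI allI)
  show "0 \<in> Range A"
    using linear_operator_zero[OF assms] by blast
  show "y + y' \<in> Range A" if "y \<in> Range A" "y' \<in> Range A" for y y'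
    using that linear_operator_add[OF assms] by (metis Range_iff)
  show "c *\<^sub>C y \<in> Range A" if "y \<in> Range A" for c y
    using that linear_operator_scaleC[OF assms] by (metis Range_iff)
qed

lemma linear_operator_imp_subspace: "linear_operator A \<Longrightarrow> subspace A"
  unfolding subspace_def
  by (auto simp: zero_prod_def intro: linear_operator_zero linear_operator_add linear_operator_scaleR)

lemma closed_graphD:
  assumes "closed A" "\<And>n. (x n, y n) \<in> A" "x \<longlonglongrightarrow> a" "y \<longlonglongrightarrow> b"
  shows "(a, b) \<in> A"
  using closed_sequentially[OF assms(1), of "\<lambda>n. (x n, y n)"] assms(2-) tendsto_Pair by blast

lemma oper_apply_eq: "linear_operator A \<Longrightarrow> (x, y) \<in> A \<Longrightarrow> oper_apply A x = y"
  unfolding oper_apply_def by (blast intro: linear_operator_unique)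

lemma oper_applyI: "linear_operator A \<Longrightarrow> x \<in> Domain A \<Longrightarrow> (x, oper_apply A x) \<in> A"
  using oper_apply_eq by fastforce

lemma oper_adjointD: "(y, z) \<in> oper_adjoint A \<Longrightarrow> (x, w) \<in> A \<Longrightarrow> cinner y w = cinner z x"
  unfolding oper_adjoint_def by blast

lemma oper_adjoint_add:
  "(y, z) \<in> oper_adjoint A \<Longrightarrow> (y', z') \<in> oper_adjoint A \<Longrightarrow> (y + y', z + z') \<in> oper_adjoint A"
  unfolding oper_adjoint_def by (auto simp: cinner_add_left)

lemma oper_adjoint_scaleC: "(y, z) \<in> oper_adjoint A \<Longrightarrow> (c *\<^sub>C y, c *\<^sub>C z) \<in> oper_adjoint A"
  unfolding oper_adjoint_def by (auto simp: cinner_scaleC_left)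

lemma oper_adjoint_scaleR: "(y, z) \<in> oper_adjoint A \<Longrightarrow> (c *\<^sub>R y, c *\<^sub>R z) \<in> oper_adjoint A"
  using oper_adjoint_scaleC[of y z A "complex_of_real c"] by (simp add: scaleC_of_real)

lemma oper_adjoint_diff:
  "(y, z) \<in> oper_adjoint A \<Longrightarrow> (y', z') \<in> oper_adjoint A \<Longrightarrow> (y - y', z - z') \<in> oper_adjoint A"
  using oper_adjoint_add[of y z A "-y'" "-z'"] oper_adjoint_scaleR[of y' z' A "-1"] by simp

lemma oper_adjoint_zero: "(0, 0) \<in> oper_adjoint A"
  unfolding oper_adjoint_def by (simp add: cinner.zero_left)

lemma subspace_Domain_oper_adjoint: "subspace (Domain (oper_adjoint A))"
  unfolding subspace_def
  by (auto intro: oper_adjoint_zero oper_adjoint_add oper_adjoint_scaleR)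

text \<open>If \<open>q\<close> is orthogonal to the domain of the adjoint, project \<open>(0, q)\<close> onto the graph of
  \<open>A\<close>: the orthogonal part \<open>(w1, w2)\<close> gives \<open>(w2, -w1)\<close> in the adjoint and must vanish.\<close>

lemma densely_defined_oper_adjoint:
  fixes A :: "('a::complex_hilbert, 'b::complex_hilbert) oper"
  assumes A: "linear_operator A" "closed A"
  shows "densely_defined (oper_adjoint A)"
  unfolding densely_defined_def
proof (rule dense_subspaceI[OF subspace_Domain_oper_adjoint])
  fix q :: 'b
  assume q: "inner q s = 0" if "s \<in> Domain (oper_adjoint A)" for s
  obtain p w where pw: "(0, q) = p + w" "p \<in> A" "\<And>s. s \<in> A \<Longrightarrow> inner w s = 0"
    using closed_subspace_decomposition[OF linear_operator_imp_subspace[OF A(1)] A(2)] by blast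
  obtain w1 w2 where w: "w = (w1, w2)"
    by (cases w)
  have orth: "inner w1 x + inner w2 y = 0" if "(x, y) \<in> A" for x y
    using pw(3)[OF that] by (simp add: w)
  have "(w2, - w1) \<in> oper_adjoint A"
    unfolding oper_adjoint_def
  proof (intro CollectI case_prodI allI impI)
    fix x y
    assume xy: "(x, y) \<in> A"
    show "cinner w2 y = cinner (- w1) x"
    proof (rule complex_eqI)
      show "Re (cinner w2 y) = Re (cinner (- w1) x)"
        using orth[OF xy] by (simp add: inner_eq_Re_cinner cinner.minus_left)
      \<comment> \<open>The graph point multiplied by \<open>\<i>\<close> supplies the imaginary
        part.\<close>
      show "Im (cinner w2 y) = Im (cinner (- w1) x)"
        using orth[OF linear_operator_scaleC[OF A(1) xy, of \<i>]]
        by (simp add: inner_eq_Re_cinner cinner.minus_left cinner_scaleC_right)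
    qed
  qed
  then have "inner w2 q = 0"
    using q[of w2] by (auto simp: inner_commute)
  moreover have p: "p = (- w1, q - w2)"
    using pw(1) w by (cases p) (auto simp: algebra_simps eq_neg_iff_add_eq_0)
  then have "inner w1 (- w1) + inner w2 (q - w2) = 0"
    using orth pw(2) by blast
  ultimately have "(norm w1)\<^sup>2 + (norm w2)\<^sup>2 = 0"
    by (simp add: inner_diff_right power2_norm_eq_inner)
  then have "w1 = 0" "w2 = 0"
    by (simp_all add: sum_power2_eq_zero_iff)
  with p pw(2) show "q = 0"
    using linear_operator_unique[OF A(1), of 0 q 0] linear_operator_zero[OF A(1)] by simp
qed

section \<open>Self-adjoint operators and their resolvents at non-real points\<close>

lemma selfadjoint_linear: "selfadjoint H \<Longrightarrow> linear_operator H"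
  unfolding selfadjoint_def by blast

lemma selfadjoint_symmetric:
  "selfadjoint H \<Longrightarrow> (x, y) \<in> H \<Longrightarrow> (x', y') \<in> H \<Longrightarrow> cinner x y' = cinner y x'"
  unfolding selfadjoint_def using oper_adjointD by metis

lemma selfadjointI_mem:
  assumes "selfadjoint H" "\<And>x w. (x, w) \<in> H \<Longrightarrow> cinner y w = cinner z x"
  shows "(y, z) \<in> H"
  using assms unfolding selfadjoint_def oper_adjoint_def by blast

lemma closed_oper_adjoint: "closed (oper_adjoint A)"
proof -
  have "oper_adjoint A = (\<Inter>(x, w)\<in>A. {p. cinner (fst p) w = cinner (snd p) x})"
    by (auto simp: oper_adjoint_def)
  moreover have "closed {p. cinner (fst p) w = cinner (snd p) x}" for x w
    by (intro closed_Collect_eq cinner.continuous_on continuous_intros)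
  ultimately show ?thesis
    by (auto intro!: closed_INT)
qed

lemma selfadjoint_closed: "selfadjoint H \<Longrightarrow> closed H"
  unfolding selfadjoint_def using closed_oper_adjoint by metis

text \<open>Symmetry makes \<open>cinner y x\<close> real, so \<open>y - Re z *\<^sub>R x\<close> is
  orthogonal to \<open>\<i> *\<^sub>C x\<close> in the real inner product, and Pythagoras
  applies.\<close>

lemma selfadjoint_norm_shift:
  assumes "selfadjoint H" "(x, y) \<in> H"
  shows "(norm (y - z *\<^sub>C x))\<^sup>2 = (norm (y - Re z *\<^sub>R x))\<^sup>2 + (Im z)\<^sup>2 * (norm x)\<^sup>2"
proof -
  define v where "v = y - Re z *\<^sub>R x"
  have "Im (cinner y x) = 0"
    using selfadjoint_symmetric[OF assms assms(2)] cinner_commute[of x y]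
    by (metis complex_cnj_cancel_iff cnj.simps(2) equal_neg_zero)
  then have "Im (cinner v x) = 0"
    by (simp add: v_def cinner.diff_left cinner.scaleR_left cinner_self)
  then have "inner v (\<i> *\<^sub>C x) = 0"
    by (simp add: inner_eq_Re_cinner cinner_scaleC_right)
  moreover have "z *\<^sub>C x = Re z *\<^sub>R x + Im z *\<^sub>R (\<i> *\<^sub>C x)"
    unfolding scaleC_of_real [symmetric] scaleC_scaleC scaleC_add_left [symmetric]
    by (metis complex_eq mult.commute)
  then have "y - z *\<^sub>C x = v - Im z *\<^sub>R (\<i> *\<^sub>C x)"
    by (simp add: v_def)
  moreover have "inner (\<i> *\<^sub>C x) (\<i> *\<^sub>C x) = inner x x"
    by (simp add: dot_square_norm norm_scaleC)
  ultimately show ?thesis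
    unfolding v_def [symmetric] power2_norm_eq_inner
    by (simp add: inner_diff_left inner_diff_right inner_commute power2_eq_square)
qed

lemma selfadjoint_norm_ge_Im:
  assumes "selfadjoint H" "(x, g + z *\<^sub>C x) \<in> H"
  shows "\<bar>Im z\<bar> * norm x \<le> norm g"
proof -
  have "(norm g)\<^sup>2 = (norm (g + z *\<^sub>C x - Re z *\<^sub>R x))\<^sup>2 + (\<bar>Im z\<bar> * norm x)\<^sup>2"
    using selfadjoint_norm_shift[OF assms, of z] by (simp add: power_mult_distrib)
  then have "(\<bar>Im z\<bar> * norm x)\<^sup>2 \<le> (norm g)\<^sup>2"
    by simp
  then show ?thesis
    by (rule power2_le_imp_le) simp
qed

text \<open>Lets a lower bound at the real point \<open>Re z\<close> control the resolvent at
  \<open>z\<close>, uniformly in the imaginary part.\<close>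

lemma selfadjoint_norm_shift_mono:
  assumes "selfadjoint H" "(x, g + z *\<^sub>C x) \<in> H"
  shows "norm (g + z *\<^sub>C x - Re z *\<^sub>R x) \<le> norm g"
proof -
  have "(norm g)\<^sup>2 = (norm (g + z *\<^sub>C x - Re z *\<^sub>R x))\<^sup>2 + (Im z)\<^sup>2 * (norm x)\<^sup>2"
    using selfadjoint_norm_shift[OF assms, of z] by simp
  then have "(norm (g + z *\<^sub>C x - Re z *\<^sub>R x))\<^sup>2 \<le> (norm g)\<^sup>2"
    by simp
  then show ?thesis
    by (rule power2_le_imp_le) simp
qed

text \<open>The lower bound \<open>selfadjoint_norm_ge_Im\<close> makes the range of
  \<open>H - z\<close> closed; a vector orthogonal to it is an eigenvector for \<open>cnj z\<close>,
  hence zero.\<close>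

lemma resolvent_exists:
  fixes H :: "('a::complex_hilbert, 'a) oper"
  assumes H: "selfadjoint H" and z: "Im z \<noteq> 0"
  shows "\<exists>x. (x, g + z *\<^sub>C x) \<in> H"
proof -
  note lin = selfadjoint_linear[OF H]
  define S where "S = {g. \<exists>x. (x, g + z *\<^sub>C x) \<in> H}"
  have subS: "subspace S"
    unfolding subspace_def S_def
  proof safe
    show "\<exists>x. (x, 0 + z *\<^sub>C x) \<in> H"
      using linear_operator_zero[OF lin] by (intro exI[of _ 0]) (simp add: scaleC.zero_right)
  next
    fix g h x y
    assume "(x, g + z *\<^sub>C x) \<in> H" "(y, h + z *\<^sub>C y) \<in> H"
    from linear_operator_add[OF lin this]
    show "\<exists>x. (x, g + h + z *\<^sub>C x) \<in> H"
      by (intro exI[of _ "x + y"]) (simp add: scaleC_add_right algebra_simps)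
  next
    fix c g x
    assume "(x, g + z *\<^sub>C x) \<in> H"
    from linear_operator_scaleR[OF lin this, of c]
    show "\<exists>x. (x, c *\<^sub>R g + z *\<^sub>C x) \<in> H"
      by (intro exI[of _ "c *\<^sub>R x"]) (simp add: scaleC.scaleR_right algebra_simps)
  qed
  have "closed S"
    unfolding closed_sequential_limits
  proof safe
    fix g and l
    assume gS: "\<forall>n. g n \<in> S" and lim: "g \<longlonglongrightarrow> l"
    have "\<forall>n. \<exists>x. (x, g n + z *\<^sub>C x) \<in> H"
      using gS by (simp add: S_def)
    then obtain x where x: "\<And>n. (x n, g n + z *\<^sub>C x n) \<in> H"
      by metis
    have le: "\<bar>Im z\<bar> * dist (x m) (x n) \<le> dist (g m) (g n)" for m n
    proof -
      have "(x m - x n, (g m - g n) + z *\<^sub>C (x m - x n)) \<in> H"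
        using linear_operator_diff[OF lin x[of m] x[of n]] by (simp add: scaleC.diff_right algebra_simps)
      from selfadjoint_norm_ge_Im[OF H this] show ?thesis
        by (simp add: dist_norm)
    qed
    have "Cauchy x"
    proof (rule metric_CauchyI)
      fix e :: real
      assume "e > 0"
      then have "\<bar>Im z\<bar> * e > 0"
        using z by simp
      then obtain N where N: "\<And>m n. m \<ge> N \<Longrightarrow> n \<ge> N \<Longrightarrow> dist (g m) (g n) < \<bar>Im z\<bar> * e"
        using metric_CauchyD[OF LIMSEQ_imp_Cauchy[OF lim]] by blast
      have "dist (x m) (x n) < e" if "m \<ge> N" "n \<ge> N" for m n
        using order_le_less_trans[OF le N[OF that]] z by simp
      then show "\<exists>N. \<forall>m\<ge>N. \<forall>n\<ge>N. dist (x m) (x n) < e"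
        by blast
    qed
    then obtain y where y: "x \<longlonglongrightarrow> y"
      using Cauchy_convergent_iff convergent_def by blast
    have "(y, l + z *\<^sub>C y) \<in> H"
      by (rule closed_graphD[OF selfadjoint_closed[OF H] x y])
        (intro tendsto_add lim scaleC.tendsto tendsto_const y)
    then show "l \<in> S"
      unfolding S_def by blast
  qed
  have "g \<in> S"
  proof -
    obtain p q where pq: "g = p + q" "p \<in> S" "\<And>s. s \<in> S \<Longrightarrow> inner q s = 0"
      using closed_subspace_decomposition[OF subS \<open>closed S\<close>] by blast
    have "csubspace S"
      unfolding csubspace_def
    proof (intro conjI allI ballI)
      fix c s
      assume "s \<in> S"
      then obtain x where "(x, s + z *\<^sub>C x) \<in> H"
        unfolding S_def by blast
      from linear_operator_scaleC[OF lin this, of c] show "c *\<^sub>C s \<in> S"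
        unfolding S_def
        by (intro CollectI exI[of _ "c *\<^sub>C x"]) (simp add: scaleC_add_right scaleC_scaleC mult.commute)
    qed (use subS subspace_0 subspace_add in blast)+
    \<comment> \<open>The summand \<open>0\<close> puts the eigenvector equation into the form
      required by \<open>selfadjoint_norm_ge_Im\<close>.\<close>
    have "(q, 0 + cnj z *\<^sub>C q) \<in> H"
    proof (rule selfadjointI_mem[OF H])
      fix x w
      assume "(x, w) \<in> H"
      then have "w - z *\<^sub>C x \<in> S"
        by (auto simp: S_def intro!: exI[of _ x])
      then have "cinner q (w - z *\<^sub>C x) = 0"
        using csubspace_orthogonal[OF \<open>csubspace S\<close>, of q] pq(3) by blast
      then show "cinner q w = cinner (0 + cnj z *\<^sub>C q) x"
        by (simp add: cinner.diff_right cinner_scaleC_right cinner_scaleC_left)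
    qed
    from selfadjoint_norm_ge_Im[OF H this] z have "q = 0"
      by (simp add: mult_le_0_iff)
    with pq show ?thesis
      by simp
  qed
  then show ?thesis
    by (simp add: S_def)
qed

section \<open>Fredholm self-adjoint operators\<close>

lemma mem_oper_shift_iff: "(x, w) \<in> oper_shift H z \<longleftrightarrow> (x, w + z *\<^sub>C x) \<in> H"
proof
  show "(x, w) \<in> oper_shift H z \<Longrightarrow> (x, w + z *\<^sub>C x) \<in> H"
    by (auto simp: oper_shift_def oper_add_def graph_of_def)
  assume "(x, w + z *\<^sub>C x) \<in> H"
  moreover have "w = (w + z *\<^sub>C x) + - (z *\<^sub>C x)"
    by simp
  ultimately show "(x, w) \<in> oper_shift H z"
    unfolding oper_shift_def oper_add_def graph_of_def by blast
qed

lemma mem_resolvent_iff: "(g, x) \<in> resolvent H z \<longleftrightarrow> (x, g + z *\<^sub>C x) \<in> H"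
  by (simp add: resolvent_def mem_oper_shift_iff)

lemma csubspace_eigenspace:
  assumes "linear_operator H"
  shows "csubspace (eigenspace H z)"
  unfolding csubspace_def
proof (intro conjI ballI allI)
  show "0 \<in> eigenspace H z"
    using linear_operator_zero[OF assms] by (simp add: eigenspace_def scaleC.zero_right)
  show "x + y \<in> eigenspace H z" if "x \<in> eigenspace H z" "y \<in> eigenspace H z" for x y
    using linear_operator_add[OF assms] that by (simp add: eigenspace_def scaleC_add_right)
  show "c *\<^sub>C x \<in> eigenspace H z" if "x \<in> eigenspace H z" for c x
    using linear_operator_scaleC[OF assms, of x "z *\<^sub>C x" c] that
    by (simp add: eigenspace_def scaleC_scaleC mult.commute)
qed

lemma closed_eigenspace:
  assumes "closed H"
  shows "closed (eigenspace H z)"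
  unfolding closed_sequential_limits
proof (intro allI impI)
  fix x a
  assume "(\<forall>n. x n \<in> eigenspace H z) \<and> x \<longlonglongrightarrow> a"
  then have "\<And>n. (x n, z *\<^sub>C x n) \<in> H" "x \<longlonglongrightarrow> a"
    by (simp_all add: eigenspace_def)
  then have "(a, z *\<^sub>C a) \<in> H"
    by (rule closed_graphD[OF assms]) (intro scaleC.tendsto tendsto_const \<open>x \<longlonglongrightarrow> a\<close>)
  then show "a \<in> eigenspace H z"
    by (simp add: eigenspace_def)
qed

text \<open>A violating sequence, scaled to be unbounded with bounded images, is weakly bounded:
  it is orthogonal to the eigenspace, and symmetry bounds its inner products with the range.\<close>

lemma fredholm_coercive:
  fixes H :: "('a::complex_hilbert, 'a) oper" and l :: real
  assumes H: "selfadjoint H" and fred: "fredholm (oper_shift H (complex_of_real l))"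
  obtains c where "c > 0"
    "\<And>x w. (x, w + l *\<^sub>R x) \<in> H \<Longrightarrow> (\<And>s. s \<in> eigenspace H (complex_of_real l) \<Longrightarrow> inner x s = 0)
      \<Longrightarrow> c * norm x \<le> norm w"
proof (rule ccontr)
  assume "\<not> thesis"
  note lin = selfadjoint_linear[OF H]
  let ?N = "eigenspace H (complex_of_real l)"
  have "\<exists>x w. (x, w + l *\<^sub>R x) \<in> H \<and> (\<forall>s\<in>?N. inner x s = 0) \<and> norm w < inverse (real (Suc n)) * norm x" for n
    using that[of "inverse (real (Suc n))"] \<open>\<not> thesis\<close> by (force simp: not_le)
  then obtain x w where xw: "\<And>n. (x n, w n + l *\<^sub>R x n) \<in> H" "\<And>n s. s \<in> ?N \<Longrightarrow> inner (x n) s = 0"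
      "\<And>n. norm (w n) < inverse (real (Suc n)) * norm (x n)"
    by metis
  have nz: "norm (x n) > 0" for n
    using xw(3)[of n] by (cases "x n = 0") auto
  \<comment> \<open>Since \<open>norm (w n)\<close> is below
    \<open>norm (x n) / real (Suc n)\<close>, this scaling gives the vectors norm
    \<open>real (Suc n)\<close> while their images stay in the unit ball.\<close>
  define a where "a n = real (Suc n) / norm (x n)" for n
  have a_pos: "a n > 0" for n
    using nz by (simp add: a_def)
  have aw: "norm (a n *\<^sub>R w n) \<le> 1" for n
  proof -
    have "norm (a n *\<^sub>R w n) = a n * norm (w n)"
      using a_pos[of n] by simp
    also have "\<dots> \<le> a n * (inverse (real (Suc n)) * norm (x n))"
      using a_pos[of n] xw(3)[of n] by (intro mult_left_mono) auto
    also have "\<dots> = 1"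
      using nz[of n] by (simp add: a_def field_simps del: of_nat_Suc)
    finally show ?thesis .
  qed
  let ?M = "Range (oper_shift H (complex_of_real l))"
  have M: "closed ?M" "linear_operator (oper_shift H (complex_of_real l))"
    using fred unfolding fredholm_def by blast+
  have subM: "csubspace ?M"
    by (rule csubspace_Range[OF M(2)])
  have "bounded (range (\<lambda>n. inner (a n *\<^sub>R x n) g))" for g
  proof -
    obtain p q where pq: "g = p + q" "p \<in> ?M" "\<And>s. s \<in> ?M \<Longrightarrow> inner q s = 0"
      using closed_subspace_decomposition[OF csubspace_imp_subspace[OF subM] M(1)] by blast
    have "q \<in> ?N"
      unfolding eigenspace_def
    proof (intro CollectI selfadjointI_mem[OF H])
      fix u v
      assume "(u, v) \<in> H"
      then have "v - complex_of_real l *\<^sub>C u \<in> ?M"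
        by (auto simp: Range_iff mem_oper_shift_iff intro!: exI[of _ u])
      then have "cinner q (v - complex_of_real l *\<^sub>C u) = 0"
        using csubspace_orthogonal[OF subM, of q] pq(3) by blast
      then show "cinner q v = cinner (complex_of_real l *\<^sub>C q) u"
        by (simp add: cinner.diff_right cinner_scaleC_right cinner_scaleC_left)
    qed
    obtain v where v: "(v, p + l *\<^sub>R v) \<in> H"
      using pq(2) by (auto simp: mem_oper_shift_iff scaleC_of_real)
    have "\<bar>inner (a n *\<^sub>R x n) g\<bar> \<le> norm v" for n
    proof -
      have "inner (x n) (p + l *\<^sub>R v) = inner (w n + l *\<^sub>R x n) v"
        using selfadjoint_symmetric[OF H xw(1)[of n] v] by (simp add: inner_eq_Re_cinner)
      then have "inner (x n) p = inner (w n) v"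
        by (simp add: inner_add_left inner_add_right)
      then have "inner (a n *\<^sub>R x n) g = inner (a n *\<^sub>R w n) v"
        using xw(2)[OF \<open>q \<in> ?N\<close>] by (simp add: pq(1) inner_add_right)
      also have "\<bar>\<dots>\<bar> \<le> norm (a n *\<^sub>R w n) * norm v"
        by (rule Cauchy_Schwarz_ineq2)
      also have "\<dots> \<le> 1 * norm v"
        using aw by (intro mult_right_mono) auto
      finally show ?thesis
        by simp
    qed
    then show ?thesis
      by (auto simp: bounded_iff)
  qed
  then have "bounded (range (\<lambda>n. a n *\<^sub>R x n))"
    by (rule weakly_bounded_imp_bounded)
  then obtain b where b: "\<And>n. norm (a n *\<^sub>R x n) \<le> b"
    by (auto simp: bounded_iff)
  have "norm (a n *\<^sub>R x n) = real (Suc n)" for n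
    using nz[of n] by (simp add: a_def)
  with b have "real (Suc n) \<le> b" for n
    by metis
  then show False
    using reals_Archimedean2[of b] by (metis less_le_not_le of_nat_le_iff order_trans lessI less_imp_le)
qed

text \<open>Split each \<open>x n\<close> along the eigenspace: the orthogonal part is Cauchy by
  coercivity, and the eigenspace part is bounded in a finite-dimensional span, hence has a
  convergent subsequence.\<close>

lemma fredholm_convergent_subsequence:
  fixes H :: "('a::complex_hilbert, 'a) oper" and l :: real
  assumes H: "selfadjoint H" and fred: "fredholm (oper_shift H (complex_of_real l))"
    and xw: "\<And>n. (x n, w n + l *\<^sub>R x n) \<in> H" and bdd: "bounded (range x)" and conv: "convergent w"
  shows "\<exists>k. strict_mono k \<and> convergent (x \<circ> k)"
proof -
  note lin = selfadjoint_linear[OF H]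
  let ?N = "eigenspace H (complex_of_real l)"
  obtain c where c: "c > 0"
    "\<And>x w. (x, w + l *\<^sub>R x) \<in> H \<Longrightarrow> (\<And>s. s \<in> ?N \<Longrightarrow> inner x s = 0) \<Longrightarrow> c * norm x \<le> norm w"
    using fredholm_coercive[OF H fred] by blast
  have subN: "subspace ?N"
    by (rule csubspace_imp_subspace[OF csubspace_eigenspace[OF lin]])
  have "\<exists>p q. x n = p + q \<and> p \<in> ?N \<and> (\<forall>s\<in>?N. inner q s = 0)" for n
    using closed_subspace_decomposition[OF subN closed_eigenspace[OF selfadjoint_closed[OF H]], of "x n"]
    by metis
  then obtain p q where pq: "\<And>n. x n = p n + q n" "\<And>n. p n \<in> ?N" "\<And>n s. s \<in> ?N \<Longrightarrow> inner (q n) s = 0"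
    by metis
  \<comment> \<open>Removing an eigenvector does not change the image under
    \<open>H - l\<close>.\<close>
  have q: "(q n, w n + l *\<^sub>R q n) \<in> H" for n
    using linear_operator_diff[OF lin xw[of n], of "p n" "l *\<^sub>R p n"] pq(2)[of n]
    by (simp add: eigenspace_def scaleC_of_real pq(1) algebra_simps)
  have le: "c * dist (q m) (q n) \<le> dist (w m) (w n)" for m n
    unfolding dist_norm
  proof (rule c(2))
    show "(q m - q n, w m - w n + l *\<^sub>R (q m - q n)) \<in> H"
      using linear_operator_diff[OF lin q[of m] q[of n]] by (simp add: algebra_simps)
  qed (simp add: inner_diff_left pq(3))
  have "Cauchy q"
  proof (rule metric_CauchyI)
    fix e :: real
    assume "e > 0"
    then have "c * e > 0"
      using c by simp
    then obtain N where N: "\<And>m n. m \<ge> N \<Longrightarrow> n \<ge> N \<Longrightarrow> dist (w m) (w n) < c * e"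
      using metric_CauchyD[OF convergent_Cauchy[OF conv]] by blast
    have "dist (q m) (q n) < e" if "m \<ge> N" "n \<ge> N" for m n
      using order_le_less_trans[OF le N[OF that]] c by simp
    then show "\<exists>N. \<forall>m\<ge>N. \<forall>n\<ge>N. dist (q m) (q n) < e"
      by blast
  qed
  then have "convergent q"
    by (simp add: Cauchy_convergent_iff)
  obtain B where B: "finite B" "?N \<subseteq> span B"
    using fred unfolding fredholm_def
    by (auto simp: eigenspace_def oper_kernel_def mem_oper_shift_iff)
  obtain b where b: "\<And>n. norm (x n) \<le> b"
    using bdd by (auto simp: bounded_iff)
  have "norm (p n) \<le> b" for n
  proof -
    have "(norm (p n))\<^sup>2 \<le> (norm (x n))\<^sup>2"
      using pq(3)[OF pq(2)[of n], of n] unfolding pq(1)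
      by (simp add: power2_norm_eq_inner inner_add_left inner_add_right inner_commute)
    then show ?thesis
      using b[of n] power2_le_imp_le[of "norm (p n)" "norm (x n)"] by simp
  qed
  then obtain K where "compact K" "\<And>n. p n \<in> K"
    using bounded_span_subset_compact[OF B(1), of b] B(2) pq(2) by fastforce
  then obtain k t where k: "strict_mono k" "(p \<circ> k) \<longlonglongrightarrow> t"
    unfolding compact_eq_seq_compact_metric seq_compact_def by metis
  have "convergent (\<lambda>n. (p \<circ> k) n + (q \<circ> k) n)"
    using convergent_subseq_convergent[OF \<open>convergent q\<close> k(1)] convergentI[OF k(2)]
    by (intro convergent_add)
  with k(1) show ?thesis
    by (auto simp: o_def pq(1))
qed

lemma relatively_compactD:
  fixes u :: "nat \<Rightarrow> 'a::complex_inner"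
  assumes "relatively_compact V H" "\<And>n. (u n, w n) \<in> H" "\<And>n. (u n, v n) \<in> V"
    "bounded (range u)" "bounded (range w)"
  shows "\<exists>k. strict_mono k \<and> convergent (v \<circ> k)"
proof -
  have "\<forall>(u :: nat \<Rightarrow> 'a) v w. (\<forall>n. (u n, w n) \<in> H \<and> (u n, v n) \<in> V) \<and> bounded (range u) \<and> bounded (range w) \<longrightarrow>
      (\<exists>k. strict_mono k \<and> convergent (v \<circ> k))"
    using assms(1) unfolding relatively_compact_def by (rule conjunct2)
  from this[THEN spec, of u, THEN spec, of v, THEN spec, of w] show ?thesis
    using assms(2-) by blast
qed

section \<open>Dense sets and one-sided limits\<close>

lemma dense_induct:
  fixes f :: "'a::topological_space"
  assumes "closure S = UNIV" "closed {x. P x}" "\<And>x. x \<in> S \<Longrightarrow> P x"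
  shows "P f"
  using closure_minimal[of S "{x. P x}"] assms by auto

text \<open>By density and continuity the bound extends to every \<open>h\<close>; then take
  \<open>h = w\<close>.\<close>

lemma norm_le_if_cinner_le_dense:
  fixes w :: "'a::complex_inner"
  assumes "closure S = UNIV" "\<And>h. h \<in> S \<Longrightarrow> cmod (cinner h w) \<le> M * norm h" "0 \<le> M"
  shows "norm w \<le> M"
proof -
  have "closed {h. cmod (cinner h w) \<le> M * norm h}"
    by (intro closed_Collect_le continuous_on_norm cinner.continuous_on continuous_intros)
  then have "cmod (cinner w w) \<le> M * norm w"
    using dense_induct[OF assms(1), where P = "\<lambda>h. cmod (cinner h w) \<le> M * norm h"] assms(2) by blast
  then have "norm w * norm w \<le> M * norm w"
    by (simp add: cinner_self power2_eq_square norm_mult)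
  then show ?thesis
    using assms(3) by (cases "w = 0") auto
qed

text \<open>A uniformly continuous map into a complete space extends to the limit point 0.\<close>

lemma lipschitz_imp_limit_at_right:
  fixes f :: "real \<Rightarrow> 'a::complete_space"
  assumes "C-lipschitz_on {0<..1} f"
  shows "\<exists>L. (f \<longlongrightarrow> L) (at_right 0)"
proof -
  have "0 \<in> closure {0<..1::real}"
    by simp
  then obtain L where "(f \<longlongrightarrow> L) (at 0 within {0<..1})"
    using uniformly_continuous_on_extension_at_closure[OF lipschitz_on_uniformly_continuous[OF assms]]
    by blast
  moreover have "at 0 within {0<..1} = at_right (0::real)"
    by (rule at_within_nhd[of _ "{..<1}"]) auto
  ultimately show ?thesis
    by auto
qed

lemma sequence_at_right: "filterlim (\<lambda>n. inverse (real (Suc n))) (at_right 0) sequentially"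
  using LIMSEQ_inverse_real_of_nat by (simp add: filterlim_at)

section \<open>The sandwiched resolvent\<close>

context rigged_affine_space
begin

section \<open>Perturbations on the common domain and lines inside the affine space\<close>

lemma dense_adjoint: "closure (Domain (oper_adjoint F)) = UNIV"
  using densely_defined_oper_adjoint[OF F_linear F_closed] by (simp add: densely_defined_def)

lemma perturbation_on_domain:
  assumes "J \<in> \<J>" "x \<in> \<D>"
  obtains u v where "(x, u) \<in> F" "(blinfun_apply J u, v) \<in> oper_adjoint F" "(x, v) \<in> perturbation F J"
proof -
  obtain v where v: "(x, v) \<in> rigged_product F J"
    using D_subset_V[OF assms(1)] assms(2) by blast
  then have "(x, v) \<in> perturbation F J"
    unfolding perturbation_def using closure_subset by blast
  with v that show thesis
    by (auto simp: rigged_product_def graph_of_def)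
qed

text \<open>Although \<open>perturbation\<close> is a closure, it takes no new values on
  \<open>\<D>\<close>: the unclosed product is already defined there and the closure is single
  valued.\<close>

lemma perturbation_adjointD:
  assumes "J \<in> \<J>" "x \<in> \<D>" "(x, v) \<in> perturbation F J" "(x, u) \<in> F"
  shows "(blinfun_apply J u, v) \<in> oper_adjoint F"
proof -
  obtain u' v' where uv: "(x, u') \<in> F" "(blinfun_apply J u', v') \<in> oper_adjoint F"
      "(x, v') \<in> perturbation F J"
    using perturbation_on_domain[OF assms(1,2)] by blast
  have "u' = u"
    by (rule linear_operator_unique[OF F_linear uv(1) assms(4)])
  moreover have "v' = v"
    by (rule linear_operator_unique[OF selfadjoint_linear[OF V_selfadjoint[OF assms(1)]] uv(3) assms(3)])
  ultimately show ?thesis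
    using uv(2) by simp
qed

lemma mem_domainD: "H \<in> \<A> \<Longrightarrow> (x, y) \<in> H \<Longrightarrow> x \<in> \<D>"
  using A_domain by blast

lemma mem_oper_line_iff:
  "(x, y) \<in> oper_line H V r \<longleftrightarrow> (\<exists>a v. (x, a) \<in> H \<and> (x, v) \<in> V \<and> y = a + r *\<^sub>R v)"
  unfolding oper_line_def oper_add_def oper_scale_def by (auto simp: scaleC_of_real)

lemma oper_line_shift:
  assumes V: "linear_operator V" and "(x, y) \<in> oper_line H V r" "(x, v) \<in> V"
  shows "(x, y + (s - r) *\<^sub>R v) \<in> oper_line H V s"
proof -
  obtain a v' where a: "(x, a) \<in> H" "(x, v') \<in> V" "y = a + r *\<^sub>R v'"
    using assms(2) unfolding mem_oper_line_iff by blast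
  then have "v' = v"
    using linear_operator_unique[OF V] assms(3) by blast
  with a show ?thesis
    unfolding mem_oper_line_iff by (intro exI[of _ a] exI[of _ v]) (simp add: algebra_simps)
qed

text \<open>Through this every operator of the line inherits self-adjointness and the domain
  \<open>\<D>\<close>. Because of the closure in \<open>perturbation\<close>, additivity in
  \<open>J\<close> is used only on \<open>\<D>\<close>, which contains the domains of both
  sides.\<close>

lemma oper_line_in_space:
  assumes H: "H \<in> \<A>" and J: "J \<in> \<J>"
  shows "oper_line H (perturbation F J) r \<in> \<A>"
proof -
  obtain H1 where A: "\<A> = {oper_add H1 (perturbation F J) | J. J \<in> \<J>}"
    using A_affine by blast
  with H obtain J0 where J0: "J0 \<in> \<J>" "H = oper_add H1 (perturbation F J0)"
    by blast
  have J': "J0 + r *\<^sub>R J \<in> \<J>"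
    using J_subspace J J0(1) by (simp add: subspace_add subspace_scale)
  have in_A: "oper_add H1 (perturbation F (J0 + r *\<^sub>R J)) \<in> \<A>"
    using A J' by blast
  have sum: "(x, v0 + r *\<^sub>R v) \<in> perturbation F (J0 + r *\<^sub>R J)"
    if x: "x \<in> \<D>" and v0: "(x, v0) \<in> perturbation F J0" and v: "(x, v) \<in> perturbation F J" for x v0 v
  proof -
    obtain u where u: "(x, u) \<in> F"
      using D_subset_F x by blast
    from oper_adjoint_add[OF perturbation_adjointD[OF J0(1) x v0 u]
        oper_adjoint_scaleR[OF perturbation_adjointD[OF J x v u], of r]]
    have "(x, v0 + r *\<^sub>R v) \<in> rigged_product F (J0 + r *\<^sub>R J)"
      using u by (auto simp: rigged_product_def graph_of_def blinfun.add_left blinfun.scaleR_left)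
    then show ?thesis
      unfolding perturbation_def using closure_subset by blast
  qed
  have "oper_line H (perturbation F J) r = oper_add H1 (perturbation F (J0 + r *\<^sub>R J))"
  proof (intro equalityI subrelI)
    fix x y
    assume "(x, y) \<in> oper_line H (perturbation F J) r"
    then obtain b v where b: "(x, b) \<in> H" "(x, v) \<in> perturbation F J" "y = b + r *\<^sub>R v"
      unfolding mem_oper_line_iff by blast
    then obtain a v0 where a: "(x, a) \<in> H1" "(x, v0) \<in> perturbation F J0" "b = a + v0"
      unfolding J0(2) oper_add_def by blast
    have "y = a + (v0 + r *\<^sub>R v)"
      by (simp add: a b)
    then show "(x, y) \<in> oper_add H1 (perturbation F (J0 + r *\<^sub>R J))"
      unfolding oper_add_def
      using a(1) sum[OF mem_domainD[OF H b(1)] a(2) b(2)] by blast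
  next
    fix x y
    assume xy: "(x, y) \<in> oper_add H1 (perturbation F (J0 + r *\<^sub>R J))"
    then have x: "x \<in> \<D>"
      by (rule mem_domainD[OF in_A])
    obtain a w where a: "(x, a) \<in> H1" "(x, w) \<in> perturbation F (J0 + r *\<^sub>R J)" "y = a + w"
      using xy unfolding oper_add_def by blast
    obtain v0 where v0: "(x, v0) \<in> perturbation F J0"
      using perturbation_on_domain[OF J0(1) x] by blast
    obtain v where v: "(x, v) \<in> perturbation F J"
      using perturbation_on_domain[OF J x] by blast
    have "w = v0 + r *\<^sub>R v"
      using linear_operator_unique[OF selfadjoint_linear[OF V_selfadjoint[OF J']] a(2) sum[OF x v0 v]] .
    moreover have "(x, a + v0) \<in> H"
      unfolding J0(2) oper_add_def using a(1) v0 by blast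
    ultimately show "(x, y) \<in> oper_line H (perturbation F J) r"
      unfolding mem_oper_line_iff using v a(3)
      by (intro exI[of _ "a + v0"] exI[of _ v]) (simp add: add.assoc)
  qed
  with in_A show ?thesis
    by simp
qed

section \<open>Values, bounds and boundary limit of the sandwiched resolvent\<close>

lemma resolvent_F_exists:
  assumes "H \<in> \<A>" "Im z \<noteq> 0"
  obtains x k where "(x, g + z *\<^sub>C x) \<in> H" "(x, k) \<in> F"
proof -
  obtain x where x: "(x, g + z *\<^sub>C x) \<in> H"
    using resolvent_exists[OF A_selfadjoint[OF assms(1)] assms(2)] by blast
  then have "x \<in> Domain F"
    using mem_domainD[OF assms(1)] D_subset_F by blast
  with x that show thesis
    by blast
qed

text \<open>The definite description in \<open>T_op\<close> is resolved by uniqueness: two bounded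
  extensions agree on the dense domain of the adjoint of \<open>F\<close>.\<close>

lemma T_op_eq:
  assumes "H \<in> \<A>" "Im z \<noteq> 0" "(f, g) \<in> oper_adjoint F" "(x, g + z *\<^sub>C x) \<in> H" "(x, k) \<in> F"
  shows "blinfun_apply (T_op F H z) f = k"
proof -
  obtain T where T: "sandwiched_resolvent F H z \<subseteq> graph_of (blinfun_apply T)"
    using T_compact[OF assms(1,2)] by blast
  have "T' = T" if T': "sandwiched_resolvent F H z \<subseteq> graph_of (blinfun_apply T')" for T'
  proof (rule blinfun_eqI)
    fix h
    show "blinfun_apply T' h = blinfun_apply T h"
    proof (rule dense_induct[OF dense_adjoint, where P = "\<lambda>h. blinfun_apply T' h = blinfun_apply T h"])
      show "closed {h. blinfun_apply T' h = blinfun_apply T h}"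
        by (intro closed_Collect_eq continuous_intros)
      fix h
      assume "h \<in> Domain (oper_adjoint F)"
      then obtain g' where g': "(h, g') \<in> oper_adjoint F"
        by blast
      obtain y m where "(y, g' + z *\<^sub>C y) \<in> H" "(y, m) \<in> F"
        using resolvent_F_exists[OF assms(1,2)] by blast
      with g' have "(h, m) \<in> sandwiched_resolvent F H z"
        unfolding sandwiched_resolvent_def by (meson mem_resolvent_iff relcompI)
      then show "blinfun_apply T' h = blinfun_apply T h"
        using T T' by (auto simp: graph_of_def)
    qed
  qed
  then have "T_op F H z = T"
    unfolding T_op_def using T by (rule the_equality[rotated])
  moreover have "(f, k) \<in> sandwiched_resolvent F H z"
    unfolding sandwiched_resolvent_def using assms by (meson mem_resolvent_iff relcompI)
  ultimately show ?thesis
    using T by (auto simp: graph_of_def)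
qed

text \<open>The resolvents at \<open>z\<close> and \<open>cnj z\<close> are adjoint: here
  \<open>x\<close> and \<open>p\<close> are their values at \<open>w\<close> and
  \<open>g\<close>.\<close>

lemma resolvent_cinner:
  assumes "selfadjoint H" "(p, g + cnj z *\<^sub>C p) \<in> H" "(x, w + z *\<^sub>C x) \<in> H"
  shows "cinner p w = cinner g x"
  using selfadjoint_symmetric[OF assms]
  by (simp add: cinner_add_left cinner_add_right cinner_scaleC_left cinner_scaleC_right)

text \<open>The left-hand side is the imaginary part of the form of \<open>T\<^sub>z\<close> at \<open>f\<close>, up to sign.\<close>

lemma resolvent_adjoint_bound:
  assumes H: "H \<in> \<A>" and z: "Im z \<noteq> 0" and f: "(f, g) \<in> oper_adjoint F"
    and p: "(p, g + cnj z *\<^sub>C p) \<in> H"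
  shows "\<bar>Im z\<bar> * (norm p)\<^sup>2 \<le> norm (T_op F H z) * (norm f)\<^sup>2"
proof -
  note sa = A_selfadjoint[OF H]
  obtain x k where x: "(x, g + z *\<^sub>C x) \<in> H" "(x, k) \<in> F"
    using resolvent_F_exists[OF H z] by blast
  have k: "blinfun_apply (T_op F H z) f = k"
    by (rule T_op_eq[OF H z f x])
  have pg: "cinner p g = cinner f k"
    using resolvent_cinner[OF sa p x(1)] oper_adjointD[OF f x(2)] by simp
  have "cinner p g + cnj z * cinner p p = cinner g p + z * cinner p p"
    using selfadjoint_symmetric[OF sa p p]
    by (simp add: cinner_add_left cinner_add_right cinner_scaleC_left cinner_scaleC_right)
  then have "Im (cinner p g + cnj z * cinner p p) = Im (cnj (cinner p g) + z * cinner p p)"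
    by (simp add: cinner_commute[of g p])
  then have "Im z * (norm p)\<^sup>2 = Im (cinner f k)"
    by (simp add: cinner_self pg)
  then have "\<bar>Im z\<bar> * (norm p)\<^sup>2 = \<bar>Im (cinner f k)\<bar>"
    by (metis abs_mult abs_power2)
  also have "\<dots> \<le> norm f * norm k"
    using abs_Im_le_cmod norm_cinner_le order_trans by blast
  also have "\<dots> \<le> norm f * (norm (T_op F H z) * norm f)"
    unfolding k [symmetric] by (intro mult_left_mono norm_blinfun) simp
  finally show ?thesis
    by (simp add: power2_eq_square algebra_simps)
qed

lemma T_op_tendsto_T_plus:
  assumes "l \<in> Lambda F H"
  shows "(\<lambda>n. T_op F H (Complex l (inverse (real (Suc n))))) \<longlonglongrightarrow> T_plus F H l"
proof -
  obtain L where L: "((\<lambda>y. T_op F H (Complex l y)) \<longlongrightarrow> L) (at_right 0)"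
    using assms unfolding Lambda_def by blast
  then have "T_plus F H l = L"
    unfolding T_plus_def by (intro tendsto_Lim) simp_all
  with filterlim_compose[OF L sequence_at_right] show ?thesis
    by simp
qed

section \<open>Eigenvectors and resonance vectors\<close>

text \<open>The identity for \<open>u\<close> is tested against the dense domain of the adjoint of
  \<open>F\<close>, where the resolvent can be moved onto the test vector. Nothing is divided by
  \<open>r - s\<close>, so \<open>r = s\<close> is allowed.\<close>

lemma eigenvector_image:
  assumes H: "H \<in> \<A>" and J: "J \<in> \<J>"
    and l: "l \<in> Lambda F (oper_line H (perturbation F J) s)"
    and x: "x \<in> eigenspace (oper_line H (perturbation F J) r) (complex_of_real l)"
    and u: "(x, u) \<in> F"
  shows "u + (r - s) *\<^sub>R blinfun_apply (T_plus F (oper_line H (perturbation F J) s) l) (blinfun_apply J u) = 0"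
proof -
  define Hs where "Hs = oper_line H (perturbation F J) s"
  define Tp where "Tp = T_plus F Hs l"
  have Hs: "Hs \<in> \<A>"
    unfolding Hs_def by (rule oper_line_in_space[OF H J])
  note sa = A_selfadjoint[OF Hs]
  have xr: "(x, complex_of_real l *\<^sub>C x) \<in> oper_line H (perturbation F J) r"
    using x by (simp add: eigenspace_def)
  have xD: "x \<in> \<D>"
    using mem_domainD[OF oper_line_in_space[OF H J] xr] .
  obtain v where v: "(x, v) \<in> perturbation F J"
    using perturbation_on_domain[OF J xD] by blast
  have Ju: "(blinfun_apply J u, v) \<in> oper_adjoint F"
    by (rule perturbation_adjointD[OF J xD v u])
  have xs: "(x, complex_of_real l *\<^sub>C x + (s - r) *\<^sub>R v) \<in> Hs"
    unfolding Hs_def by (rule oper_line_shift[OF selfadjoint_linear[OF V_selfadjoint[OF J]] xr v])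
  define y where "y n = inverse (real (Suc n))" for n
  define z where "z n = Complex l (y n)" for n
  have y_pos: "y n > 0" and Imz: "Im (z n) \<noteq> 0" "Im (z n) = y n" for n
    by (simp_all add: y_def z_def)
  have limT: "(\<lambda>n. T_op F Hs (z n)) \<longlonglongrightarrow> Tp"
    using T_op_tendsto_T_plus[OF l] by (simp add: Tp_def Hs_def z_def y_def)
  have limy: "y \<longlonglongrightarrow> 0"
    unfolding y_def by (rule LIMSEQ_inverse_real_of_nat)
  define w where "w = u + (r - s) *\<^sub>R blinfun_apply Tp (blinfun_apply J u)"
  have "cinner f w = 0" if f: "f \<in> Domain (oper_adjoint F)" for f
  proof -
    obtain g where g: "(f, g) \<in> oper_adjoint F"
      using f by blast
    have "\<exists>p. (p, g + cnj (z n) *\<^sub>C p) \<in> Hs" for n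
      using Imz by (intro resolvent_exists[OF sa]) simp
    then obtain p where p: "\<And>n. (p n, g + cnj (z n) *\<^sub>C p n) \<in> Hs"
      by metis
    \<comment> \<open>The image of \<open>x\<close> under \<open>Hs - z n\<close> is
      \<open>(l - z n) x + (s - r) v\<close>. Apply the resolvent and \<open>F\<close>, pair with
      \<open>f\<close> and move the resolvent over to \<open>p n\<close>; \<open>l - z n\<close>
      equals \<open>- \<i> * y n\<close>.\<close>
    have eq: "cinner f (u + (r - s) *\<^sub>R blinfun_apply (T_op F Hs (z n)) (blinfun_apply J u))
        = - (\<i> * complex_of_real (y n) * cinner (p n) x)" for n
    proof -
      obtain x' k where x': "(x', v + z n *\<^sub>C x') \<in> Hs" "(x', k) \<in> F"
        using resolvent_F_exists[OF Hs Imz(1)] by blast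
      have k: "blinfun_apply (T_op F Hs (z n)) (blinfun_apply J u) = k"
        by (rule T_op_eq[OF Hs Imz(1) Ju x'])
      have "cinner (p n) v = cinner f k"
        using resolvent_cinner[OF sa p x'(1)] oper_adjointD[OF g x'(2)] by simp
      moreover have "(x, ((complex_of_real l - z n) *\<^sub>C x + (s - r) *\<^sub>R v) + z n *\<^sub>C x) \<in> Hs"
        using xs by (simp add: scaleC.diff_left algebra_simps)
      from resolvent_cinner[OF sa p this]
      have "(complex_of_real l - z n) * cinner (p n) x + (s - r) *\<^sub>R cinner (p n) v = cinner f u"
        using oper_adjointD[OF g u]
        by (simp add: cinner_add_right cinner_scaleC_right cinner.scaleR_right)
      moreover have "complex_of_real l - z n = - (\<i> * complex_of_real (y n))"
        by (simp add: z_def complex_eq_iff)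
      ultimately have "cinner f u = - (\<i> * complex_of_real (y n)) * cinner (p n) x + (s - r) *\<^sub>R cinner f k"
        by simp
      then show ?thesis
        unfolding k
        by (simp add: cinner_add_right cinner.scaleR_right scaleR_conv_of_real)
          (simp add: algebra_simps)
    qed
    have bound: "norm (- (\<i> * complex_of_real (y n) * cinner (p n) x))
        \<le> sqrt (y n * (norm (T_op F Hs (z n)) * (norm f)\<^sup>2)) * norm x" for n
    proof -
      \<comment> \<open>What is known to be bounded is \<open>y n * (norm (p n))\<^sup>2\<close>;
        the spare factor \<open>y n\<close> gives decay like the square root of
        \<open>y n\<close>.\<close>
      have "(y n * norm (p n))\<^sup>2 = y n * (y n * (norm (p n))\<^sup>2)"
        by (simp add: power2_eq_square)
      also have "\<dots> \<le> y n * (norm (T_op F Hs (z n)) * (norm f)\<^sup>2)"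
        using resolvent_adjoint_bound[OF Hs Imz(1) g p, of n] y_pos[of n]
        by (intro mult_left_mono) (simp_all add: Imz(2))
      finally have "(y n * norm (p n))\<^sup>2 \<le> y n * (norm (T_op F Hs (z n)) * (norm f)\<^sup>2)" .
      then have "y n * norm (p n) \<le> sqrt (y n * (norm (T_op F Hs (z n)) * (norm f)\<^sup>2))"
        by (rule real_le_rsqrt)
      moreover have "norm (- (\<i> * complex_of_real (y n) * cinner (p n) x)) \<le> y n * norm (p n) * norm x"
        using norm_cinner_le[of "p n" x] y_pos[of n] by (simp add: norm_mult mult.assoc mult_left_mono)
      ultimately show ?thesis
        by (meson mult_right_mono norm_ge_zero order_trans)
    qed
    have "(\<lambda>n. sqrt (y n * (norm (T_op F Hs (z n)) * (norm f)\<^sup>2)) * norm x)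
        \<longlonglongrightarrow> sqrt (0 * (norm Tp * (norm f)\<^sup>2)) * norm x"
      by (intro tendsto_intros limy limT)
    then have "(\<lambda>n. sqrt (y n * (norm (T_op F Hs (z n)) * (norm f)\<^sup>2)) * norm x) \<longlonglongrightarrow> 0"
      by simp
    with always_eventually[OF allI[OF bound]]
    have "(\<lambda>n. - (\<i> * complex_of_real (y n) * cinner (p n) x)) \<longlonglongrightarrow> 0"
      by (rule Lim_null_comparison)
    then have "(\<lambda>n. cinner f (u + (r - s) *\<^sub>R blinfun_apply (T_op F Hs (z n)) (blinfun_apply J u))) \<longlonglongrightarrow> 0"
      unfolding eq .
    moreover have "(\<lambda>n. cinner f (u + (r - s) *\<^sub>R blinfun_apply (T_op F Hs (z n)) (blinfun_apply J u)))
        \<longlonglongrightarrow> cinner f w"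
      unfolding w_def by (intro cinner.tendsto blinfun.tendsto limT tendsto_intros)
    ultimately show ?thesis
      by (rule LIMSEQ_unique[symmetric])
  qed
  then have "norm w \<le> 0"
    by (intro norm_le_if_cinner_le_dense[OF dense_adjoint]) auto
  then show ?thesis
    by (simp add: w_def Tp_def Hs_def)
qed

lemma F_injective:
  assumes "(x, u) \<in> F" "(x', u) \<in> F"
  shows "x = x'"
proof -
  have "x - x' \<in> oper_kernel F"
    using linear_operator_diff[OF F_linear assms] by (simp add: oper_kernel_def)
  then show ?thesis
    by (simp add: F_kernel)
qed

section \<open>Absence of the eigenvalue, coercivity and regularity; preimages of resonance
  vectors\<close>

lemma nonresonant_not_eigenvalue:
  assumes H: "H \<in> \<A>" and J: "J \<in> \<J>"
    and l: "l \<in> Lambda F (oper_line H (perturbation F J) s)"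
  shows "\<not> eigenvalue (oper_line H (perturbation F J) s) (complex_of_real l)"
proof
  assume "eigenvalue (oper_line H (perturbation F J) s) (complex_of_real l)"
  then obtain x where x: "x \<noteq> 0" "x \<in> eigenspace (oper_line H (perturbation F J) s) (complex_of_real l)"
    unfolding eigenvalue_def by blast
  then have "x \<in> \<D>"
    using mem_domainD[OF oper_line_in_space[OF H J]] by (auto simp: eigenspace_def)
  then obtain u where u: "(x, u) \<in> F"
    using D_subset_F by blast
  have "u = 0"
    using eigenvector_image[OF H J l x(2) u] by simp
  with u x(1) F_kernel show False
    by (auto simp: oper_kernel_def)
qed

text \<open>Relative compactness transfers the Fredholm property from \<open>H\<close> along the line.\<close>

lemma not_eigenvalue_coercive:
  assumes H: "H \<in> \<A>" and J: "J \<in> \<J>"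
    and fred: "fredholm (oper_shift H (complex_of_real l))"
    and ne: "\<not> eigenvalue (oper_line H (perturbation F J) r) (complex_of_real l)"
  obtains c where "c > 0"
    "\<And>x w. (x, w + l *\<^sub>R x) \<in> oper_line H (perturbation F J) r \<Longrightarrow> c * norm x \<le> norm w"
proof (rule ccontr)
  assume contra: "\<not> thesis"
  note violated = that
  define V where "V = perturbation F J"
  define Hr where "Hr = oper_line H V r"
  have Hr: "Hr \<in> \<A>"
    unfolding Hr_def V_def by (rule oper_line_in_space[OF H J])
  note lin = selfadjoint_linear[OF A_selfadjoint[OF Hr]]
  have "\<exists>x w. (x, w + l *\<^sub>R x) \<in> Hr \<and> norm x = 1 \<and> norm w < inverse (real (Suc n))" for n
  proof -
    obtain x w where xw: "(x, w + l *\<^sub>R x) \<in> Hr" "norm w < inverse (real (Suc n)) * norm x"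
      using violated[of "inverse (real (Suc n))"] contra
      unfolding Hr_def V_def by (force simp: not_le)
    then have nz: "norm x > 0"
      by (cases "x = 0") auto
    have "(inverse (norm x) *\<^sub>R x, inverse (norm x) *\<^sub>R w + l *\<^sub>R (inverse (norm x) *\<^sub>R x)) \<in> Hr"
      using linear_operator_scaleR[OF lin xw(1), of "inverse (norm x)"]
      by (simp add: scaleR_add_right mult.commute)
    moreover have "norm (inverse (norm x) *\<^sub>R w) < inverse (real (Suc n))"
      using nz xw(2) by (simp add: field_simps del: of_nat_Suc)
    ultimately show ?thesis
      using nz by (intro exI[of _ "inverse (norm x) *\<^sub>R x"] exI[of _ "inverse (norm x) *\<^sub>R w"]) simp
  qed
  then obtain x w where x: "\<And>n. (x n, w n + l *\<^sub>R x n) \<in> Hr" "\<And>n. norm (x n) = 1"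
      and w: "\<And>n. norm (w n) < inverse (real (Suc n))"
    by metis
  have limw: "w \<longlonglongrightarrow> 0"
    by (rule Lim_null_comparison[OF always_eventually[OF allI[OF less_imp_le[OF w]]]
        LIMSEQ_inverse_real_of_nat])
  have "\<exists>v. (x n, v) \<in> V" for n
    using perturbation_on_domain[OF J mem_domainD[OF Hr x(1)]] unfolding V_def by blast
  then obtain v where v: "\<And>n. (x n, v n) \<in> V"
    by metis
  have bx: "bounded (range x)"
    using x(2) by (auto simp: bounded_iff)
  have "bounded (range (\<lambda>n. w n + l *\<^sub>R x n))"
    by (intro bounded_plus_comp bounded_scaleR_comp bx convergent_imp_bounded[OF limw])
  from relatively_compactD[OF V_relatively_compact[OF J Hr, folded V_def] x(1) v bx this]
  obtain k where k: "strict_mono k" "convergent (v \<circ> k)"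
    by blast
  \<comment> \<open>The sequence was chosen for \<open>Hr\<close>, but along \<open>k\<close> its
    images under \<open>H - l\<close> converge as well, so the Fredholm property of \<open>H\<close>
    becomes applicable.\<close>
  have xk: "((x \<circ> k) n, (w (k n) - r *\<^sub>R v (k n)) + l *\<^sub>R (x \<circ> k) n) \<in> H" for n
  proof -
    obtain a v' where a: "(x (k n), a) \<in> H" "(x (k n), v') \<in> V" "w (k n) + l *\<^sub>R x (k n) = a + r *\<^sub>R v'"
      using x(1)[of "k n"] unfolding Hr_def mem_oper_line_iff by blast
    have "v' = v (k n)"
      using linear_operator_unique[OF selfadjoint_linear[OF V_selfadjoint[OF J]]] a(2) v
      unfolding V_def by blast
    with a show ?thesis
      by (simp add: algebra_simps)
  qed
  obtain v0 where "(\<lambda>n. v (k n)) \<longlonglongrightarrow> v0"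
    using k(2) by (auto simp: convergent_def o_def)
  moreover have "(\<lambda>n. w (k n)) \<longlonglongrightarrow> 0"
    using LIMSEQ_subseq_LIMSEQ[OF limw k(1)] by (simp add: o_def)
  ultimately have "(\<lambda>n. w (k n) - r *\<^sub>R v (k n)) \<longlonglongrightarrow> 0 - r *\<^sub>R v0"
    by (intro tendsto_intros)
  then have conv: "convergent (\<lambda>n. w (k n) - r *\<^sub>R v (k n))"
    by (rule convergentI)
  have "bounded (range (x \<circ> k))"
    by (rule bounded_subset[OF bx]) auto
  from fredholm_convergent_subsequence[OF A_selfadjoint[OF H] fred xk this conv]
  obtain j where j: "strict_mono j" "convergent ((x \<circ> k) \<circ> j)"
    by blast
  then obtain t where t: "(\<lambda>n. x (k (j n))) \<longlonglongrightarrow> t"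
    by (auto simp: convergent_def o_def)
  have "strict_mono (k \<circ> j)"
    using k(1) j(1) by (rule strict_mono_o)
  from LIMSEQ_subseq_LIMSEQ[OF limw this] have "(\<lambda>n. w (k (j n))) \<longlonglongrightarrow> 0"
    by (simp add: o_def)
  then have "(\<lambda>n. w (k (j n)) + l *\<^sub>R x (k (j n))) \<longlonglongrightarrow> 0 + l *\<^sub>R t"
    by (intro tendsto_intros t)
  \<comment> \<open>The limit \<open>t\<close> is a unit eigenvector of \<open>Hr\<close>,
    contradicting \<open>ne\<close>.\<close>
  then have "(t, 0 + l *\<^sub>R t) \<in> Hr"
    by (rule closed_graphD[OF selfadjoint_closed[OF A_selfadjoint[OF Hr]] x(1) t])
  moreover have "norm t = 1"
    using LIMSEQ_unique[OF tendsto_norm[OF t]] x(2) by simp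
  then have "t \<noteq> 0"
    by auto
  ultimately show False
    using ne by (auto simp: eigenvalue_def eigenspace_def scaleC_of_real Hr_def V_def)
qed

text \<open>At the fixed reference point \<open>w = Complex l 1\<close> the bound comes from
  \<open>resolvent_adjoint_bound\<close>. The difference \<open>p - q\<close> solves the equation at
  \<open>z\<close> with right-hand side \<open>(z - w) *\<^sub>C q\<close>, which coercivity at
  \<open>l\<close> controls uniformly in \<open>z\<close>.\<close>

lemma resolvent_adjoint_uniform:
  assumes H: "H \<in> \<A>" and c: "c > 0" "\<And>x w. (x, w + l *\<^sub>R x) \<in> H \<Longrightarrow> c * norm x \<le> norm w"
  obtains C where "C \<ge> 0"
    "\<And>z f g p. Re z = l \<Longrightarrow> Im z \<noteq> 0 \<Longrightarrow> \<bar>Im z\<bar> \<le> 1 \<Longrightarrow> (f, g) \<in> oper_adjoint F \<Longrightarrow>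
      (p, g + z *\<^sub>C p) \<in> H \<Longrightarrow> norm p \<le> C * norm f"
proof -
  note sa = A_selfadjoint[OF H]
  define w where "w = Complex l 1"
  \<comment> \<open>\<open>resolvent_adjoint_bound\<close> estimates the resolvent at the conjugate
    of the point of \<open>T_op\<close>, hence \<open>cnj w\<close>; its imaginary part has modulus
    1.\<close>
  define b where "b = sqrt (norm (T_op F H (cnj w)))"
  have "b \<ge> 0"
    by (simp add: b_def)
  have "norm p \<le> (1 + 2 / c) * b * norm f"
    if z: "Re z = l" "Im z \<noteq> 0" "\<bar>Im z\<bar> \<le> 1" and f: "(f, g) \<in> oper_adjoint F"
      and p: "(p, g + z *\<^sub>C p) \<in> H" for z f g p
  proof -
    obtain q where q: "(q, g + w *\<^sub>C q) \<in> H"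
      using resolvent_exists[OF sa, of w] by (auto simp: w_def)
    have "(norm q)\<^sup>2 \<le> norm (T_op F H (cnj w)) * (norm f)\<^sup>2"
      using resolvent_adjoint_bound[OF H _ f, of "cnj w" q] q by (simp add: w_def)
    then have "(norm q)\<^sup>2 \<le> (b * norm f)\<^sup>2"
      by (simp add: b_def power_mult_distrib)
    then have norm_q: "norm q \<le> b * norm f"
      using \<open>b \<ge> 0\<close> by (rule power2_le_imp_le[OF _ mult_nonneg_nonneg]) simp_all
    have "(p - q, (z - w) *\<^sub>C q + z *\<^sub>C (p - q)) \<in> H"
      using linear_operator_diff[OF selfadjoint_linear[OF sa] p q]
      by (simp add: scaleC.diff_left scaleC.diff_right algebra_simps)
    note pq = this
    have "(p - q, ((z - w) *\<^sub>C q + z *\<^sub>C (p - q) - l *\<^sub>R (p - q)) + l *\<^sub>R (p - q)) \<in> H"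
      using pq by simp
    then have "c * norm (p - q) \<le> norm ((z - w) *\<^sub>C q + z *\<^sub>C (p - q) - l *\<^sub>R (p - q))"
      by (rule c(2))
    also have "\<dots> \<le> norm ((z - w) *\<^sub>C q)"
      using selfadjoint_norm_shift_mono[OF sa pq] z(1) by simp
    also have "\<dots> = \<bar>Im z - 1\<bar> * norm q"
      using z(1) by (simp add: norm_scaleC w_def cmod_def)
    also have "\<dots> \<le> 2 * (b * norm f)"
      using z(3) norm_q by (intro mult_mono) auto
    finally have "norm (p - q) \<le> 2 / c * (b * norm f)"
      using c(1) by (simp add: field_simps)
    moreover have "norm p \<le> norm q + norm (p - q)"
      using norm_triangle_ineq[of q "p - q"] by simp
    ultimately show ?thesis
      using norm_q by (simp add: algebra_simps)
  qed
  then show thesis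
    using \<open>b \<ge> 0\<close> c(1) by (intro that[of "(1 + 2 / c) * b"]) auto
qed

text \<open>By the resolvent identity the difference of the operators at \<open>z\<close> and
  \<open>z'\<close> is \<open>z - z'\<close> times the product of \<open>F R_z\<close> and
  \<open>R_z' F*\<close>. \<open>resolvent_adjoint_uniform\<close> bounds the second factor, and
  through its adjoint the first, each by \<open>C\<close>.\<close>

lemma coercive_imp_Lambda:
  assumes H: "H \<in> \<A>" and c: "c > 0" "\<And>x w. (x, w + l *\<^sub>R x) \<in> H \<Longrightarrow> c * norm x \<le> norm w"
  shows "l \<in> Lambda F H"
proof -
  note sa = A_selfadjoint[OF H]
  obtain C where C: "C \<ge> 0"
    "\<And>z f g p. Re z = l \<Longrightarrow> Im z \<noteq> 0 \<Longrightarrow> \<bar>Im z\<bar> \<le> 1 \<Longrightarrow> (f, g) \<in> oper_adjoint F \<Longrightarrow>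
      (p, g + z *\<^sub>C p) \<in> H \<Longrightarrow> norm p \<le> C * norm f"
    using resolvent_adjoint_uniform[OF H c] by blast
  have "(C * C)-lipschitz_on {0<..1} (\<lambda>y. T_op F H (Complex l y))"
  proof (rule lipschitz_onI)
    fix a b :: real
    assume ab: "a \<in> {0<..1}" "b \<in> {0<..1}"
    define z where "z = Complex l a"
    define z' where "z' = Complex l b"
    have z: "Re z = l" "Im z \<noteq> 0" "\<bar>Im z\<bar> \<le> 1" "Re z' = l" "Im z' \<noteq> 0" "\<bar>Im z'\<bar> \<le> 1"
      using ab by (simp_all add: z_def z'_def)
    have zz: "cmod (z - z') = dist a b"
      by (simp add: z_def z'_def cmod_def dist_real_def)
    have main: "norm (blinfun_apply (T_op F H z - T_op F H z') f) \<le> C * C * dist a b * norm f"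
      if f: "f \<in> Domain (oper_adjoint F)" for f
    proof -
      obtain g where g: "(f, g) \<in> oper_adjoint F"
        using f by blast
      obtain x k where x: "(x, g + z *\<^sub>C x) \<in> H" "(x, k) \<in> F"
        using resolvent_F_exists[OF H z(2)] by blast
      obtain x' k' where x': "(x', g + z' *\<^sub>C x') \<in> H" "(x', k') \<in> F"
        using resolvent_F_exists[OF H z(5)] by blast
      have k: "blinfun_apply (T_op F H z - T_op F H z') f = k - k'"
        using T_op_eq[OF H z(2) g x] T_op_eq[OF H z(5) g x'] by (simp add: blinfun.diff_left)
      have diff: "(x - x', (z - z') *\<^sub>C x' + z *\<^sub>C (x - x')) \<in> H"
        using linear_operator_diff[OF selfadjoint_linear[OF sa] x(1) x'(1)]
        by (simp add: scaleC.diff_left scaleC.diff_right algebra_simps)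
      have "norm (k - k') \<le> dist a b * (C * (C * norm f))"
      proof (rule norm_le_if_cinner_le_dense[OF dense_adjoint])
        fix h
        assume "h \<in> Domain (oper_adjoint F)"
        then obtain g' where g': "(h, g') \<in> oper_adjoint F"
          by blast
        \<comment> \<open>The test vector \<open>h\<close> meets the adjoint of
          \<open>F R_z\<close>, so its resolvent is taken at \<open>cnj z\<close>.\<close>
        obtain p where p: "(p, g' + cnj z *\<^sub>C p) \<in> H"
          using resolvent_exists[OF sa, of "cnj z"] z(2) by auto
        have "cinner h (k - k') = cinner g' (x - x')"
          using oper_adjointD[OF g' linear_operator_diff[OF F_linear x(2) x'(2)]] .
        also have "\<dots> = (z - z') * cinner p x'"
          using resolvent_cinner[OF sa p diff] by (simp add: cinner_scaleC_right)
        finally have "cmod (cinner h (k - k')) = dist a b * cmod (cinner p x')"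
          by (simp add: norm_mult zz)
        also have "\<dots> \<le> dist a b * (norm p * norm x')"
          by (intro mult_left_mono norm_cinner_le) simp
        also have "\<dots> \<le> dist a b * ((C * norm h) * (C * norm f))"
          using C(2)[OF _ _ _ g' p] C(2)[OF z(4-6) g x'(1)] z(1-3) C(1)
          by (intro mult_left_mono mult_mono) auto
        finally show "cmod (cinner h (k - k')) \<le> dist a b * (C * (C * norm f)) * norm h"
          by (simp add: algebra_simps)
      qed (use C(1) in simp)
      then show ?thesis
        unfolding k by (simp add: ac_simps)
    qed
    have "norm (T_op F H z - T_op F H z') \<le> C * C * dist a b"
    proof (rule norm_blinfun_bound)
      fix f
      have "closed {f. norm (blinfun_apply (T_op F H z - T_op F H z') f) \<le> C * C * dist a b * norm f}"
        by (intro closed_Collect_le continuous_intros)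
      then show "norm (blinfun_apply (T_op F H z - T_op F H z') f) \<le> C * C * dist a b * norm f"
        using dense_induct[OF dense_adjoint,
            where P = "\<lambda>f. norm (blinfun_apply (T_op F H z - T_op F H z') f) \<le> C * C * dist a b * norm f"]
          main by blast
    qed (use C(1) in simp)
    then show "dist (T_op F H (Complex l a)) (T_op F H (Complex l b)) \<le> C * C * dist a b"
      by (simp add: dist_norm z_def z'_def)
  qed (use C(1) in simp)
  then show ?thesis
    unfolding Lambda_def using lipschitz_imp_limit_at_right by blast
qed

text \<open>The preimage of a resonance vector \<open>u\<close> is a multiple of the limit of \<open>R\<^sub>z(H\<^sub>s) F\<^sup>* f\<close> as
  \<open>z\<close> tends to \<open>l\<close> and \<open>f\<close> tends to \<open>J u\<close> within the domain of the adjoint.\<close>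

lemma resonance_vector_preimage:
  assumes H: "H \<in> \<A>" and J: "J \<in> \<J>"
    and l: "l \<in> Lambda F (oper_line H (perturbation F J) s)"
    and c: "c > 0"
      "\<And>x w. (x, w + l *\<^sub>R x) \<in> oper_line H (perturbation F J) s \<Longrightarrow> c * norm x \<le> norm w"
    and u: "u + (r - s) *\<^sub>R blinfun_apply (T_plus F (oper_line H (perturbation F J) s) l) (blinfun_apply J u) = 0"
  shows "\<exists>x. x \<in> eigenspace (oper_line H (perturbation F J) r) (complex_of_real l) \<and> (x, u) \<in> F"
proof -
  define V where "V = perturbation F J"
  define Hs where "Hs = oper_line H V s"
  define Hr where "Hr = oper_line H V r"
  have Hs: "Hs \<in> \<A>" and Hr: "Hr \<in> \<A>"
    unfolding Hs_def Hr_def V_def by (rule oper_line_in_space[OF H J])+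
  note sa = A_selfadjoint[OF Hs]
  define Tp where "Tp = T_plus F Hs l"
  obtain C where C: "C \<ge> 0"
    "\<And>z f g p. Re z = l \<Longrightarrow> Im z \<noteq> 0 \<Longrightarrow> \<bar>Im z\<bar> \<le> 1 \<Longrightarrow> (f, g) \<in> oper_adjoint F \<Longrightarrow>
      (p, g + z *\<^sub>C p) \<in> Hs \<Longrightarrow> norm p \<le> C * norm f"
    using resolvent_adjoint_uniform[OF Hs c(1), of l] c(2) unfolding Hs_def V_def by blast
  define z where "z n = Complex l (inverse (real (Suc n)))" for n
  have z: "Re (z n) = l" "Im (z n) \<noteq> 0" "\<bar>Im (z n)\<bar> \<le> 1" for n
    by (simp_all add: z_def inverse_le_1_iff)
  have limT: "(\<lambda>n. T_op F Hs (z n)) \<longlonglongrightarrow> Tp"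
    using T_op_tendsto_T_plus[OF l] by (simp add: Tp_def Hs_def V_def z_def)
  have limz: "z \<longlonglongrightarrow> complex_of_real l"
    unfolding z_def using tendsto_Complex[OF tendsto_const LIMSEQ_inverse_real_of_nat, of l]
    by (simp add: complex_of_real_def)
  \<comment> \<open>\<open>blinfun_apply J u\<close> is not known to lie in the domain of the
    adjoint of \<open>F\<close>, so it is approximated from there.\<close>
  obtain f where f: "\<And>n. f n \<in> Domain (oper_adjoint F)" "f \<longlonglongrightarrow> blinfun_apply J u"
    using dense_adjoint closure_sequential[of "blinfun_apply J u" "Domain (oper_adjoint F)"] by auto
  have "\<exists>g x k. (f n, g) \<in> oper_adjoint F \<and> (x, g + z n *\<^sub>C x) \<in> Hs \<and> (x, k) \<in> F" for n
  proof -
    obtain g where g: "(f n, g) \<in> oper_adjoint F"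
      using f(1) by blast
    obtain x k where "(x, g + z n *\<^sub>C x) \<in> Hs" "(x, k) \<in> F"
      using resolvent_F_exists[OF Hs z(2)] by blast
    with g show ?thesis
      by blast
  qed
  then obtain g x k where g: "\<And>n. (f n, g n) \<in> oper_adjoint F"
      and x: "\<And>n. (x n, g n + z n *\<^sub>C x n) \<in> Hs" and k: "\<And>n. (x n, k n) \<in> F"
    by metis
  have k_eq: "k n = blinfun_apply (T_op F Hs (z n)) (f n)" for n
    using T_op_eq[OF Hs z(2) g x k] by simp
  have limk: "k \<longlonglongrightarrow> blinfun_apply Tp (blinfun_apply J u)"
    unfolding k_eq by (intro blinfun.tendsto limT f(2))
  obtain b where b: "\<And>n. norm (f n) \<le> b"
    using convergent_imp_bounded[OF f(2)] by (auto simp: bounded_iff)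
  \<comment> \<open>The intermediate vector \<open>q\<close>, the resolvent at \<open>z m\<close>
    applied to \<open>g n\<close>, separates the change of data from the change of the spectral
    parameter.\<close>
  have cauchy: "c * norm (x m - x n) \<le> c * (C * dist (f m) (f n)) + C * b * dist (z m) (z n)" for m n
  proof -
    obtain q where q: "(q, g n + z m *\<^sub>C q) \<in> Hs"
      using resolvent_exists[OF sa z(2)] by blast
    have "(x m - q, (g m - g n) + z m *\<^sub>C (x m - q)) \<in> Hs"
      using linear_operator_diff[OF selfadjoint_linear[OF sa] x[of m] q]
      by (simp add: scaleC.diff_right add_diff_add)
    from C(2)[OF z[of m] oper_adjoint_diff[OF g g] this]
    have 1: "norm (x m - q) \<le> C * dist (f m) (f n)"
      by (simp add: dist_norm)
    have d: "(q - x n, (z m - z n) *\<^sub>C x n + z m *\<^sub>C (q - x n)) \<in> Hs"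
      using linear_operator_diff[OF selfadjoint_linear[OF sa] q x[of n]]
      by (simp add: scaleC.diff_left scaleC.diff_right algebra_simps)
    then have "(q - x n, ((z m - z n) *\<^sub>C x n + z m *\<^sub>C (q - x n) - l *\<^sub>R (q - x n)) + l *\<^sub>R (q - x n)) \<in> Hs"
      by simp
    then have "c * norm (q - x n) \<le> norm ((z m - z n) *\<^sub>C x n + z m *\<^sub>C (q - x n) - l *\<^sub>R (q - x n))"
      using c(2) unfolding Hs_def V_def by blast
    also have "\<dots> \<le> norm ((z m - z n) *\<^sub>C x n)"
      using selfadjoint_norm_shift_mono[OF sa d] z(1)[of m] by simp
    also have "\<dots> \<le> dist (z m) (z n) * (C * b)"
      using order_trans[OF C(2)[OF z g x] mult_left_mono[OF b C(1)]]
      by (auto simp: norm_scaleC dist_norm intro!: mult_left_mono)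
    finally have 2: "c * norm (q - x n) \<le> C * b * dist (z m) (z n)"
      by (simp add: algebra_simps)
    have "norm (x m - x n) \<le> norm (x m - q) + norm (q - x n)"
      using norm_triangle_ineq[of "x m - q" "q - x n"] by simp
    then have "c * norm (x m - x n) \<le> c * norm (x m - q) + c * norm (q - x n)"
      using c(1) by (simp flip: distrib_left)
    also have "\<dots> \<le> c * (C * dist (f m) (f n)) + C * b * dist (z m) (z n)"
      using 1 2 c(1) by (intro add_mono mult_left_mono) auto
    finally show ?thesis .
  qed
  have "b \<ge> 0"
    using b[of 0] norm_ge_zero order_trans by blast
  have "Cauchy x"
  proof (rule metric_CauchyI)
    fix e :: real
    assume "e > 0"
    \<comment> \<open>The summand 1 keeps the denominator positive and makes the final estimate
      strict.\<close>
    define e' where "e' = c * e / (c * C + C * b + 1)"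
    have den: "c * C + C * b + 1 > 0"
      using c(1) C(1) \<open>b \<ge> 0\<close> by (simp add: add_nonneg_pos)
    then have "e' > 0"
      using c(1) \<open>e > 0\<close> by (simp add: e'_def)
    obtain N1 where N1: "\<And>m n. m \<ge> N1 \<Longrightarrow> n \<ge> N1 \<Longrightarrow> dist (f m) (f n) < e'"
      using metric_CauchyD[OF LIMSEQ_imp_Cauchy[OF f(2)] \<open>e' > 0\<close>] by blast
    obtain N2 where N2: "\<And>m n. m \<ge> N2 \<Longrightarrow> n \<ge> N2 \<Longrightarrow> dist (z m) (z n) < e'"
      using metric_CauchyD[OF LIMSEQ_imp_Cauchy[OF limz] \<open>e' > 0\<close>] by blast
    have "dist (x m) (x n) < e" if "m \<ge> max N1 N2" "n \<ge> max N1 N2" for m n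
    proof -
      have "c * norm (x m - x n) \<le> c * (C * dist (f m) (f n)) + C * b * dist (z m) (z n)"
        by (rule cauchy)
      also have "\<dots> \<le> c * (C * e') + C * b * e'"
        using N1[of m n] N2[of m n] that c(1) C(1) \<open>b \<ge> 0\<close>
        by (intro add_mono mult_left_mono) auto
      also have "\<dots> < (c * C + C * b + 1) * e'"
        using \<open>e' > 0\<close> by (simp add: algebra_simps)
      also have "\<dots> = c * e"
        using den by (simp add: e'_def)
      finally show ?thesis
        using c(1) by (simp add: dist_norm)
    qed
    then show "\<exists>N. \<forall>m\<ge>N. \<forall>n\<ge>N. dist (x m) (x n) < e"
      by blast
  qed
  then obtain x0 where x0: "x \<longlonglongrightarrow> x0"
    using Cauchy_convergent_iff convergent_def by blast
  have Fx0: "(x0, blinfun_apply Tp (blinfun_apply J u)) \<in> F"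
    by (rule closed_graphD[OF F_closed k x0 limk])
  \<comment> \<open>No convergence of \<open>g n\<close> is known, so the limit equation is taken
    weakly, where only the limit of \<open>f n\<close> enters.\<close>
  have weak: "cinner x0 (a - complex_of_real l *\<^sub>C y) = cinner (blinfun_apply J u) d"
    if y: "(y, a) \<in> Hs" "(y, d) \<in> F" for y a d
  proof -
    have eq: "cinner (x n) (a - cnj (z n) *\<^sub>C y) = cinner (f n) d" for n
    proof -
      have "(x n, g n + cnj (cnj (z n)) *\<^sub>C x n) \<in> Hs" "(y, (a - cnj (z n) *\<^sub>C y) + cnj (z n) *\<^sub>C y) \<in> Hs"
        using x y by simp_all
      from resolvent_cinner[OF sa this] show ?thesis
        using oper_adjointD[OF g y(2)] by simp
    qed
    have "(\<lambda>n. cinner (x n) (a - cnj (z n) *\<^sub>C y)) \<longlonglongrightarrow> cinner x0 (a - cnj (complex_of_real l) *\<^sub>C y)"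
      by (intro cinner.tendsto scaleC.tendsto tendsto_intros x0 limz)
    moreover have "(\<lambda>n. cinner (f n) d) \<longlonglongrightarrow> cinner (blinfun_apply J u) d"
      by (intro cinner.tendsto tendsto_intros f(2))
    ultimately have "cinner x0 (a - cnj (complex_of_real l) *\<^sub>C y) = cinner (blinfun_apply J u) d"
      unfolding eq by (rule LIMSEQ_unique)
    then show ?thesis
      by simp
  qed
  \<comment> \<open>The resonance equation says that \<open>u\<close> is \<open>s - r\<close> times
    the image of \<open>x0\<close> under \<open>F\<close>, which dictates this multiple.\<close>
  define x1 where "x1 = (s - r) *\<^sub>R x0"
  have u_eq: "u = (s - r) *\<^sub>R blinfun_apply Tp (blinfun_apply J u)"
    using u unfolding Tp_def Hs_def V_def by (simp add: eq_neg_iff_add_eq_0 algebra_simps)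
  have Fx1: "(x1, u) \<in> F"
    unfolding x1_def by (subst u_eq) (rule linear_operator_scaleR[OF F_linear Fx0])
  have "(x1, complex_of_real l *\<^sub>C x1) \<in> Hr"
  proof (rule selfadjointI_mem[OF A_selfadjoint[OF Hr]])
    fix y a
    assume ya: "(y, a) \<in> Hr"
    have yD: "y \<in> \<D>"
      by (rule mem_domainD[OF Hr ya])
    obtain d v where d: "(y, d) \<in> F" "(blinfun_apply J d, v) \<in> oper_adjoint F" "(y, v) \<in> V"
      using perturbation_on_domain[OF J yD] unfolding V_def by blast
    have "(y, a + (s - r) *\<^sub>R v) \<in> Hs"
      unfolding Hs_def
      by (rule oper_line_shift[OF _ ya[unfolded Hr_def] d(3)])
        (simp add: V_def selfadjoint_linear[OF V_selfadjoint[OF J]])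
    from weak[OF this d(1)]
    have 1: "cinner x0 (a + (s - r) *\<^sub>R v - complex_of_real l *\<^sub>C y) = cinner (blinfun_apply J u) d" .
    \<comment> \<open>Symmetry of \<open>J\<close> turns the right-hand side of the weak equation
      into the pairing of \<open>x1\<close> with \<open>v\<close>, which cancels the term by which
      \<open>Hs\<close> differs from \<open>Hr\<close>.\<close>
    have "cinner (blinfun_apply J d) u = cinner v x1"
      by (rule oper_adjointD[OF d(2) Fx1])
    then have "cinner u (blinfun_apply J d) = cinner x1 v"
      by (metis cinner_commute)
    then have "cinner (blinfun_apply J u) d = cinner x1 v"
      using J_selfadjoint[OF J] unfolding bounded_selfadjoint_def by simp
    with 1 have "cinner x0 (a + (s - r) *\<^sub>R v - complex_of_real l *\<^sub>C y) = (s - r) *\<^sub>R cinner x0 v"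
      by (simp add: x1_def cinner.scaleR_left)
    then have "cinner x0 a = complex_of_real l * cinner x0 y"
      by (simp add: cinner_add_right cinner.diff_right cinner.scaleR_right cinner_scaleC_right)
    then show "cinner x1 a = cinner (complex_of_real l *\<^sub>C x1) y"
      by (simp add: x1_def cinner.scaleR_left cinner_scaleC_left)
  qed
  with Fx1 show ?thesis
    unfolding eigenspace_def Hr_def V_def by blast
qed

end

section \<open>Assembly of the isomorphism\<close>

theorem theorem1p25:
  fixes F :: "('h::complex_hilbert, 'k::complex_hilbert) oper"
    and \<J> :: "('k \<Rightarrow>\<^sub>L 'k) set"
    and \<A> :: "('h, 'h) oper set"
    and \<D> :: "'h set"
    and l r s :: real
    and H\<^sub>0 V :: "('h, 'h) oper"
    and J :: "'k \<Rightarrow>\<^sub>L 'k"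
  assumes "rigged_affine_space F \<J> \<A> \<D>"
    and "H\<^sub>0 \<in> \<A>"
    and "complex_of_real l \<notin> ess_spectrum H\<^sub>0"
    and "J \<in> \<J>"
    and "V = perturbation F J"
    and "regular_line F l H\<^sub>0 V"
    and "resonance_point F l H\<^sub>0 V r"
    and "\<not> resonance_point F l H\<^sub>0 V s"
  shows "eigenvalue (oper_line H\<^sub>0 V r) (complex_of_real l) \<and>
     eigenspace (oper_line H\<^sub>0 V r) (complex_of_real l) \<subseteq> Domain F \<and>
     linear_isomorphism_on (oper_apply F)
           (eigenspace (oper_line H\<^sub>0 V r) (complex_of_real l))
           (Upsilon1 F l H\<^sub>0 J s r) \<and>
     Upsilon1 F l H\<^sub>0 J s r =
           eigenspace (graph_of (\<lambda>u. blinfun_apply (T_plus F (oper_line H\<^sub>0 V s) l) (blinfun_apply J u)))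
             (complex_of_real (inverse (s - r)))"
proof -
  interpret rigged_affine_space F \<J> \<A> \<D>
    by (rule assms(1))
  note V = assms(5) and H = assms(2) and J = assms(4)
  define N where "N = eigenspace (oper_line H\<^sub>0 V r) (complex_of_real l)"
  define U where "U = Upsilon1 F l H\<^sub>0 J s r"
  have fred: "fredholm (oper_shift H\<^sub>0 (complex_of_real l))"
    using assms(3) by (simp add: ess_spectrum_def)
  have r: "l \<notin> Lambda F (oper_line H\<^sub>0 (perturbation F J) r)"
    using assms(7) by (simp add: resonance_point_def V)
  have s: "l \<in> Lambda F (oper_line H\<^sub>0 (perturbation F J) s)"
    using assms(8) by (simp add: resonance_point_def V)
  \<comment> \<open>This keeps \<open>inverse (s - r)\<close> from being the default value
    \<open>inverse 0 = 0\<close>.\<close>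
  have "r \<noteq> s"
    using r s by blast
  have Hr: "oper_line H\<^sub>0 V r \<in> \<A>"
    unfolding V by (rule oper_line_in_space[OF H J])
  have ev: "eigenvalue (oper_line H\<^sub>0 V r) (complex_of_real l)"
  proof (rule ccontr)
    assume "\<not> eigenvalue (oper_line H\<^sub>0 V r) (complex_of_real l)"
    then obtain c where "c > 0"
      "\<And>x w. (x, w + l *\<^sub>R x) \<in> oper_line H\<^sub>0 (perturbation F J) r \<Longrightarrow> c * norm x \<le> norm w"
      using not_eigenvalue_coercive[OF H J fred, of r] unfolding V by blast
    then show False
      using coercive_imp_Lambda[OF oper_line_in_space[OF H J]] r by blast
  qed
  have dom: "N \<subseteq> Domain F"
    using mem_domainD[OF Hr] D_subset_F by (auto simp: N_def eigenspace_def)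
  have FN: "(x, oper_apply F x) \<in> F" if "x \<in> N" for x
    using oper_applyI[OF F_linear] dom that by blast
  have csN: "csubspace N"
    unfolding N_def by (rule csubspace_eigenspace[OF selfadjoint_linear[OF A_selfadjoint[OF Hr]]])
  have add: "oper_apply F (x + y) = oper_apply F x + oper_apply F y" if "x \<in> N" "y \<in> N" for x y
    by (rule oper_apply_eq[OF F_linear linear_operator_add[OF F_linear FN[OF that(1)] FN[OF that(2)]]])
  have scale: "oper_apply F (c *\<^sub>C x) = c *\<^sub>C oper_apply F x" if "x \<in> N" for c x
    by (rule oper_apply_eq[OF F_linear linear_operator_scaleC[OF F_linear FN[OF that]]])
  have inj: "inj_on (oper_apply F) N"
    using F_injective FN by (metis inj_onI)
  have image: "oper_apply F ` N = U"
  proof (intro equalityI subsetI)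
    fix u
    assume "u \<in> oper_apply F ` N"
    then obtain x where x: "x \<in> N" "(x, u) \<in> F"
      using FN by blast
    show "u \<in> U"
      unfolding U_def Upsilon1_def
      using eigenvector_image[OF H J s x(1)[unfolded N_def V] x(2)] by simp
  next
    fix u
    assume u: "u \<in> U"
    obtain c where "c > 0"
      "\<And>x w. (x, w + l *\<^sub>R x) \<in> oper_line H\<^sub>0 (perturbation F J) s \<Longrightarrow> c * norm x \<le> norm w"
      using not_eigenvalue_coercive[OF H J fred nonresonant_not_eigenvalue[OF H J s]] by blast
    from resonance_vector_preimage[OF H J s this, of u r]
    obtain x where "x \<in> N" "(x, u) \<in> F"
      using u unfolding U_def Upsilon1_def N_def V by blast
    then show "u \<in> oper_apply F ` N"
      using oper_apply_eq[OF F_linear] by blast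
  qed
  have iso: "linear_isomorphism_on (oper_apply F) N U"
    unfolding linear_isomorphism_on_def
    using csN csubspace_image[OF csN, of "oper_apply F"] add scale image inj
    by (auto simp: bij_betw_def)
  have "u + (r - s) *\<^sub>R t = 0 \<longleftrightarrow> complex_of_real (inverse (s - r)) *\<^sub>C u = t" for u t :: 'k
  proof -
    have "u + (r - s) *\<^sub>R t = 0 \<longleftrightarrow> u = (s - r) *\<^sub>R t"
      by (simp add: eq_neg_iff_add_eq_0 algebra_simps)
    also have "\<dots> \<longleftrightarrow> inverse (s - r) *\<^sub>R u = t"
      using \<open>r \<noteq> s\<close> by auto
    finally show ?thesis
      by (simp only: scaleC_of_real)
  qed
  then have "U = eigenspace (graph_of (\<lambda>u. blinfun_apply (T_plus F (oper_line H\<^sub>0 V s) l) (blinfun_apply J u)))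
      (complex_of_real (inverse (s - r)))"
    by (auto simp: U_def Upsilon1_def eigenspace_def graph_of_def V)
  with ev dom iso show ?thesis
    unfolding N_def U_def by blast
qed

end
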